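(* Let $d\in\{1,2,3\}$, let $\Omega\subset\mathbb{R}^d$ be a bounded domain, $\Gamma_D\subseteq\partial\Omega$, and $V=\{v\in H^1(\Omega): v|_{\Gamma_D}=0\}$, where $\Gamma_D$ is such that the bilinear form $a(v,u)=\int_\Omega\nabla v\cdot\nabla u\,d\mathbf{x}$ is coercive on $V$. Let $\mathcal{T}_h$ be a mesh of $\Omega$ into quadrilateral/hexahedral cells $K=F_K(\hat K)$, with $\hat K=[-1,1]^d$ and $F_K:\hat K\to K$ a diffeomorphism. For each $K\in\mathcal{T}_h$ let $$\hat G^K=|\det(\mathrm{D}F_K)|\,(\mathrm{D}F_K)^{-1}(\mathrm{D}F_K)^{-\top}:\hat K\to\mathbb{R}^{d\times d},\qquad \mu^K_j=\frac{1}{|\hat K|}\int_{\hat K}\hat G^K_{jj}\,d\hat{\mathbf{x}}\quad (j=1,\dots,d),$$ and let $\hat\mu_K=\operatorname{diag}(\mu^K_1,\dots,\mu^K_d)$ be the constant diagonal approximation of $\hat G^K$. Define the auxiliary bilinear form $$\tilde a(v,u)=\sum_{K\in\mathcal{T}_h}\int_{\hat K}\hat\nabla(v\circ F_K)\cdot\hat\mu_K\,\hat\nabla(u\circ F_K)\,d\hat{\mathbf{x}},\qquad u,v\in V.$$ Then there exist constants $c,C>0$, which depend on the mesh $\mathcal{T}_h$ through the tensors $\hat G^K$ ($K\in\mathcal{T}_h$) and are independent of the polynomial degree $p$ of the finite element discretization, such that $$c\le\frac{a(v,v)}{\tilde a(v,v)}\le C\qquad\text{for all } v\in V\setminus\{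0\}.$$
   Context: A mesh $\mathcal{T}_h$ of $\Omega$ is a finite collection of closed cells $K$ with pairwise disjoint interiors whose union is $\overline\Omega$. Each cell is the image of the closed reference hypercube $\hat K=[-1,1]^d$ under a diffeomorphism $F_K$ ($C^1$ up to the boundary, with everywhere invertible Jacobian matrix $\mathrm{D}F_K$ on $\hat K$). $\hat\nabla$ denotes the gradient with respect to the reference coordinates $\hat{\mathbf{x}}\in\hat K$, and $|\hat K|$ is the Lebesgue measure of $\hat K$. $\hat G^K_{jj}$ denotes the $j$-th diagonal entry of $\hat G^K$ (no summation over $j$). By change of variables, the form $a$ can be written as $$a(v,u)=\sum_{K\in\mathcal{T}_h}\int_{\hat K}\hat\nabla(v\circ F_K)\cdot\hat G^K\,\hat\nabla(u\circ F_K)\,d\hat{\mathbf{x}}.$$ The degree $p$ refers to the finite element space $V_h\subset V$ of continuous functions whose restriction to each $K$ is $\hat v\circ F_K^{-1}$ with $\hat v$ a polynomial of degree at most $p$ in each variable; the inequality is asserted on the whole space $V$, with $c,C$ not depending on $p$. *)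

theory Defs
  imports "HOL-Analysis.Analysis"
begin

section \<open>The Sobolev space of order one\<close>

definition gradient :: "(real^'n \<Rightarrow> real) \<Rightarrow> real^'n \<Rightarrow> real^'n" where
  "gradient \<phi> x = (\<chi> j. frechet_derivative \<phi> (at x) (axis j 1))"

text \<open>Continuously differentiable functions on the whole space whose (compact) support lies
  in \<open>U\<close>.  First-order weak derivatives are tested against this class, as in
  Gilbarg and Trudinger, Section 7.3; it yields the same derivatives as smooth test functions.\<close>

definition test_functions :: "(real^'n) set \<Rightarrow> (real^'n \<Rightarrow> real) set" where
  "test_functions U = {\<phi>. (\<forall>x. \<phi> differentiable (at x)) \<and> continuous_on UNIV (gradient \<phi>) \<and>
     compact (closure {x. \<phi> x \<noteq> 0}) \<and> closure {x. \<phi> x \<noteq> 0} \<subseteq> U}"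

definition locally_integrable :: "(real^'n) set \<Rightarrow> (real^'n \<Rightarrow> 'b::{banach, second_countable_topology}) \<Rightarrow> bool" where
  "locally_integrable U f \<longleftrightarrow> (\<forall>S. compact S \<and> S \<subseteq> U \<longrightarrow> set_integrable lebesgue S f)"

definition has_weak_gradient ::
    "(real^'n) set \<Rightarrow> (real^'n \<Rightarrow> real) \<Rightarrow> (real^'n \<Rightarrow> real^'n) \<Rightarrow> bool" where
  "has_weak_gradient U f g \<longleftrightarrow> locally_integrable U f \<and> locally_integrable U g \<and>
     (\<forall>\<phi>\<in>test_functions U. \<forall>j.
        (LINT x:U|lebesgue. f x * gradient \<phi> x $ j) = - (LINT x:U|lebesgue. g x $ j * \<phi> x))"

text \<open>The weak gradient is unique up to null sets, so every use below is independent of the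
  choice of representative.  It is extended by zero outside the open set \<open>U\<close>.\<close>

definition weak_gradient :: "(real^'n) set \<Rightarrow> (real^'n \<Rightarrow> real) \<Rightarrow> real^'n \<Rightarrow> real^'n" where
  "weak_gradient U f x = (if x \<in> U then (SOME g. has_weak_gradient U f g) x else 0)"

text \<open>Elements of Lebesgue and Sobolev spaces are represented by functions on the whole space of
  which only the values on the domain matter; they are not quotiented by almost everywhere
  equality.\<close>

definition H1 :: "(real^'n) set \<Rightarrow> (real^'n \<Rightarrow> real) set" where
  "H1 \<Omega> = {v. v \<in> borel_measurable (lebesgue_on \<Omega>) \<and> set_integrable lebesgue \<Omega> (\<lambda>x. (v x)\<^sup>2) \<and>
     (\<exists>g. has_weak_gradient \<Omega> v g \<and> set_integrable lebesgue \<Omega> (\<lambda>x. (norm (g x))\<^sup>2))}"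

definition H1_norm :: "(real^'n) set \<Rightarrow> (real^'n \<Rightarrow> real) \<Rightarrow> real" where
  "H1_norm \<Omega> v = sqrt ((LINT x:\<Omega>|lebesgue. (v x)\<^sup>2) +
     (LINT x:\<Omega>|lebesgue. (norm (weak_gradient \<Omega> v x))\<^sup>2))"

section \<open>Traces on the boundary\<close>

text \<open>Hausdorff (outer) measure of dimension \<open>s\<close>, up to the normalising constant.  Unbounded sets
  must be excluded, since the library gives them a meaningless \<open>diameter\<close>; the empty set must
  count zero also for \<open>s = 0\<close>, where the measure is the counting measure.\<close>

definition hausdorff_measure :: "nat \<Rightarrow> (real^'n) set \<Rightarrow> ennreal" where
  "hausdorff_measure s N = (SUP \<delta>\<in>{0<..}.
     INF A\<in>{A :: nat \<Rightarrow> (real^'n) set.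
               N \<subseteq> (\<Union>i. A i) \<and> (\<forall>i. bounded (A i) \<and> diameter (A i) \<le> \<delta>)}.
       \<Sum>i. if A i = {} then 0 else ennreal (diameter (A i) ^ s))"

text \<open>Pointwise description of the trace, meaningful on every domain.  On a Lipschitz domain it
  holds at surface-almost every boundary point with the value of the usual trace operator
  (Evans and Gariepy, Section 5.3).\<close>

definition has_trace_at :: "(real^'n) set \<Rightarrow> (real^'n \<Rightarrow> real) \<Rightarrow> real^'n \<Rightarrow> real \<Rightarrow> bool" where
  "has_trace_at \<Omega> v x t \<longleftrightarrow>
     ((\<lambda>r. (LINT y:ball x r \<inter> \<Omega>|lebesgue. \<bar>v y - t\<bar>) / measure lebesgue (ball x r \<inter> \<Omega>))
        \<longlongrightarrow> 0) (at_right 0)"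

definition zero_trace_on :: "(real^'n) set \<Rightarrow> (real^'n) set \<Rightarrow> (real^'n \<Rightarrow> real) \<Rightarrow> bool" where
  "zero_trace_on \<Omega> \<Gamma> v \<longleftrightarrow>
     hausdorff_measure (CARD('n) - 1) {x\<in>\<Gamma>. \<not> has_trace_at \<Omega> v x 0} = 0"

definition space_V :: "(real^'n) set \<Rightarrow> (real^'n) set \<Rightarrow> (real^'n \<Rightarrow> real) set" where
  "space_V \<Omega> \<Gamma>D = {v \<in> H1 \<Omega>. zero_trace_on \<Omega> \<Gamma>D v}"

definition form_a :: "(real^'n) set \<Rightarrow> (real^'n \<Rightarrow> real) \<Rightarrow> (real^'n \<Rightarrow> real) \<Rightarrow> real" where
  "form_a \<Omega> v u = (LINT x:\<Omega>|lebesgue. weak_gradient \<Omega> v x \<bullet> weak_gradient \<Omega> u x)"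

definition coercive_on ::
    "(real^'n) set \<Rightarrow> ((real^'n \<Rightarrow> real) \<Rightarrow> (real^'n \<Rightarrow> real) \<Rightarrow> real) \<Rightarrow> (real^'n \<Rightarrow> real) set \<Rightarrow> bool" where
  "coercive_on \<Omega> b V \<longleftrightarrow> (\<exists>\<alpha>>0. \<forall>v\<in>V. b v v \<ge> \<alpha> * (H1_norm \<Omega> v)\<^sup>2)"

section \<open>Meshes\<close>

definition ref_cube :: "(real^'n) set" where
  "ref_cube = cbox (\<chi> i. -1) (\<chi> i. 1)"

text \<open>One-sided at boundary points of the reference cube, where it is still unique.\<close>

definition jacobian_matrix :: "(real^'n \<Rightarrow> real^'n) \<Rightarrow> real^'n \<Rightarrow> real^'n^'n" where
  "jacobian_matrix F x = matrix (frechet_derivative F (at x within ref_cube))"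

text \<open>The differentiability of the inverse map is a consequence.\<close>

definition cell_diffeo :: "(real^'n \<Rightarrow> real^'n) \<Rightarrow> (real^'n) set \<Rightarrow> bool" where
  "cell_diffeo F K \<longleftrightarrow> bij_betw F ref_cube K \<and> F differentiable_on ref_cube \<and>
     continuous_on ref_cube (jacobian_matrix F) \<and> (\<forall>x\<in>ref_cube. invertible (jacobian_matrix F x))"

definition is_mesh ::
    "(real^'n) set \<Rightarrow> (real^'n) set set \<Rightarrow> ((real^'n) set \<Rightarrow> real^'n \<Rightarrow> real^'n) \<Rightarrow> bool" where
  "is_mesh \<Omega> \<T> F \<longleftrightarrow> finite \<T> \<and> (\<forall>K\<in>\<T>. cell_diffeo (F K) K) \<and>
     (\<forall>K\<in>\<T>. \<forall>L\<in>\<T>. K \<noteq> L \<longrightarrow> interior K \<inter> interior L = {}) \<and> \<Union>\<T> = closure \<Omega>"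

text \<open>\<open>restrict\<close> makes this a function on the reference cube only.\<close>

definition G_hat :: "(real^'n \<Rightarrow> real^'n) \<Rightarrow> real^'n \<Rightarrow> real^'n^'n" where
  "G_hat F = restrict (\<lambda>x. \<bar>det (jacobian_matrix F x)\<bar> *\<^sub>R
     (matrix_inv (jacobian_matrix F x) ** transpose (matrix_inv (jacobian_matrix F x)))) ref_cube"

definition mu :: "(real^'n \<Rightarrow> real^'n) \<Rightarrow> 'n \<Rightarrow> real" where
  "mu F j = 1 / measure lebesgue (ref_cube :: (real^'n) set) *
     (LINT x:ref_cube|lebesgue. G_hat F x $ j $ j)"

definition mu_hat :: "(real^'n \<Rightarrow> real^'n) \<Rightarrow> real^'n^'n" where
  "mu_hat F = (\<chi> i j. if i = j then mu F j else 0)"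

text \<open>A function on \<open>\<Omega>\<close> is pulled back to the points of the open reference cube that
  \<open>F\<close> maps into \<open>\<Omega>\<close>; this is the whole open cube whenever the interior of
  the cell lies in \<open>\<Omega>\<close>.\<close>

definition ref_gradient ::
    "(real^'n) set \<Rightarrow> (real^'n \<Rightarrow> real^'n) \<Rightarrow> (real^'n \<Rightarrow> real) \<Rightarrow> real^'n \<Rightarrow> real^'n" where
  "ref_gradient \<Omega> F v = weak_gradient (interior ref_cube \<inter> F -` \<Omega>) (v \<circ> F)"

definition form_a_tilde :: "(real^'n) set \<Rightarrow> (real^'n) set set \<Rightarrow>
    ((real^'n) set \<Rightarrow> real^'n \<Rightarrow> real^'n) \<Rightarrow> (real^'n \<Rightarrow> real) \<Rightarrow> (real^'n \<Rightarrow> real) \<Rightarrow> real" where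
  "form_a_tilde \<Omega> \<T> F v u = (\<Sum>K\<in>\<T>. LINT x:ref_cube|lebesgue.
     ref_gradient \<Omega> (F K) v x \<bullet> (mu_hat (F K) *v ref_gradient \<Omega> (F K) u x))"

end

theory Submission
  imports Defs
begin

text \<open>On a single cell both energies are integrals over the reference cube of a quadratic form in
  the same vector, the reference gradient \<open>r\<close> of \<open>v \<circ> F\<close>: by the chain rule
  \<open>r = J\<^sup>T (\<nabla> v \<circ> F)\<close> and the change of variables \<open>y = F x\<close>, the Dirichlet energy of \<open>v\<close> on the
  cell is \<open>\<integral> r \<bullet> G r\<close> with \<open>G\<close> the tensor of the cell, while the auxiliary energy is
  \<open>\<integral> r \<bullet> D r\<close> with \<open>D\<close> the diagonal matrix of the means of the diagonal entries of \<open>G\<close>.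
  Since the reference cube is compact and the Jacobian matrix is continuous and invertible on it,
  the eigenvalues of \<open>G\<close> lie between two positive constants \<open>l\<close> and \<open>L\<close>
  (\<open>cell_tensor_elliptic\<close>).  The diagonal entries \<open>e\<^sub>j \<bullet> G e\<^sub>j\<close>, and hence their means, lie
  between the same two constants (\<open>mu_bounds\<close>), so that both integrands lie between
  \<open>l \<bar>r\<bar>\<^sup>2\<close> and \<open>L \<bar>r\<bar>\<^sup>2\<close>.  Summing over the finitely many cells bounds the quotient of the
  energies by \<open>l / L\<close> and \<open>L / l\<close>.  These numbers are chosen from the set of the tensors alone,
  so they are independent of any polynomial degree.

  The analytic work is the chain rule for weak gradients under a map that is only continuously
  differentiable (\<open>has_weak_gradient_compose_diffeo\<close>).  For a test function \<open>\<phi>\<close> on the reference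
  side, the change of variables turns \<open>\<integral> (f \<circ> F) \<partial>\<^sub>j \<phi>\<close> into \<open>\<integral> f w\<close>, where \<open>w\<close> is the divergence of
  the Piola transform \<open>\<Psi>\<close> of the field \<open>\<phi> e\<^sub>j\<close>.  The field \<open>\<Psi>\<close> contains the Jacobian matrix, so it is
  merely continuous and its divergence is meant in the weak sense.  Mollifying \<open>\<Psi>\<close> makes it an
  admissible field of test functions; mollification commutes with the divergence and converges
  pointwise and boundedly with supports in a fixed compact set, so \<open>\<integral> f w = - \<integral> \<nabla> f \<bullet> \<Psi>\<close> holds in the
  limit (\<open>weak_gradient_against_field\<close>).  The same mollification yields the fundamental lemma of
  the calculus of variations and with it the uniqueness of weak gradients, which identifies the
  reference gradient with the one that the chain rule produces.\<close>

section \<open>Change of variables for arbitrary finite index types\<close>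

text \<open>The change of variables formula \<open>has_absolute_integral_change_of_variables\<close> concerns vectors whose
  index type is well-ordered.  A copy of an arbitrary finite index type carries such an order, by
  enumeration, and renaming the coordinates is a linear isomorphism that preserves Lebesgue measure
  and, for endomorphisms, determinants.\<close>
typedef 'a ordered_index = "UNIV :: 'a set"
  by auto

instance ordered_index :: (finite) finite
proof
  have "surj (Abs_ordered_index :: 'a \<Rightarrow> _)"
    by (metis Rep_ordered_index_inverse surj_def)
  then show "finite (UNIV :: 'a ordered_index set)"
    by (metis finite finite_imageI)
qed

instantiation ordered_index :: (countable) wellorder
begin

definition less_eq_ordered_index :: "'a ordered_index \<Rightarrow> 'a ordered_index \<Rightarrow> bool" where
  "i \<le> j \<longleftrightarrow> to_nat (Rep_ordered_index i) \<le> to_nat (Rep_ordered_index j)"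

definition less_ordered_index :: "'a ordered_index \<Rightarrow> 'a ordered_index \<Rightarrow> bool" where
  "i < j \<longleftrightarrow> to_nat (Rep_ordered_index i) < to_nat (Rep_ordered_index j)"

instance
proof
  fix P :: "'a ordered_index \<Rightarrow> bool" and a
  assume step: "\<And>x. (\<And>y. y < x \<Longrightarrow> P y) \<Longrightarrow> P x"
  show "P a"
    by (induction a rule: measure_induct_rule[of "\<lambda>i. to_nat (Rep_ordered_index i)"])
       (use step in \<open>auto simp: less_ordered_index_def\<close>)
qed (auto simp: less_eq_ordered_index_def less_ordered_index_def Rep_ordered_index_inject)

end

lemma bij_Abs_ordered_index: "bij Abs_ordered_index"
  by (metis Abs_ordered_index_inverse Rep_ordered_index_inverse UNIV_I bijI')

lemma bij_Rep_ordered_index: "bij Rep_ordered_index"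
  by (metis Abs_ordered_index_inverse Rep_ordered_index_inverse UNIV_I bijI')

definition to_ordered :: "real^'n \<Rightarrow> real^('n ordered_index)" where
  "to_ordered x = (\<chi> i. x $ Rep_ordered_index i)"

definition of_ordered :: "real^('n ordered_index) \<Rightarrow> real^'n" where
  "of_ordered x = (\<chi> i. x $ Abs_ordered_index i)"

lemma of_to_ordered [simp]: "of_ordered (to_ordered x) = x"
  by (simp add: to_ordered_def of_ordered_def Abs_ordered_index_inverse vec_eq_iff)

lemma to_of_ordered [simp]: "to_ordered (of_ordered x) = x"
  by (simp add: to_ordered_def of_ordered_def Rep_ordered_index_inverse vec_eq_iff)

lemma linear_to_ordered: "linear (to_ordered :: real^'n::finite \<Rightarrow> _)"
  by (rule linearI) (auto simp: to_ordered_def vec_eq_iff)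

lemma linear_of_ordered: "linear (of_ordered :: _ \<Rightarrow> real^'n::finite)"
  by (rule linearI) (auto simp: of_ordered_def vec_eq_iff)

lemmas bounded_linear_to_ordered = linear_conv_bounded_linear[THEN iffD1, OF linear_to_ordered]
lemmas bounded_linear_of_ordered = linear_conv_bounded_linear[THEN iffD1, OF linear_of_ordered]

text \<open>Conjugation with \<open>h\<close> is a bijection between the permutations of the two index types that
  preserves signs, so the two Leibniz sums agree term by term.\<close>
lemma det_reindex:
  fixes A :: "'a::comm_ring_1^'n^'n" and h :: "'m::finite \<Rightarrow> 'n::finite"
  assumes h: "bij h"
  shows "det (\<chi> i j. A $ h i $ h j) = det A"
proof -
  let ?T = "map_permutation UNIV h"
  have inj: "inj h"
    using h by (rule bij_is_inj)
  have perm: "?T p permutes UNIV" if "p permutes UNIV" for p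
    by (rule map_permutation_permutes) (use h that in auto)
  have bij: "bij_betw ?T {p. p permutes UNIV} {p. p permutes UNIV}"
  proof (rule bij_betw_byWitness[where f' = "map_permutation UNIV (inv h)"])
    show "\<forall>p\<in>{p. p permutes UNIV}. map_permutation UNIV (inv h) (?T p) = p"
      using h inj by (auto intro!: map_permutation_compose_inv)
    show "\<forall>p\<in>{p. p permutes UNIV}. ?T (map_permutation UNIV (inv h) p) = p"
      using h by (auto intro!: map_permutation_compose_inv bij_imp_bij_inv simp: bij_is_surj surj_f_inv_f)
    show "?T ` {p. p permutes UNIV} \<subseteq> {p. p permutes UNIV}"
      using perm by auto
    show "map_permutation UNIV (inv h) ` {p. p permutes UNIV} \<subseteq> {p. p permutes UNIV}"
      using h by (auto intro!: map_permutation_permutes bij_imp_bij_inv)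
  qed
  have "det A = (\<Sum>p | p permutes UNIV. of_int (sign (?T p)) * (\<Prod>i\<in>UNIV. A $ i $ ?T p i))"
    unfolding det_def by (rule sum.reindex_bij_betw[OF bij, symmetric])
  also have "\<dots> = (\<Sum>p | p permutes UNIV. of_int (sign p) * (\<Prod>i\<in>UNIV. A $ h i $ h (p i)))"
  proof (rule sum.cong[OF refl])
    fix p :: "'m \<Rightarrow> 'm"
    assume "p \<in> {p. p permutes UNIV}"
    then have "sign (?T p) = sign p"
      by (intro sign_map_permutation) (use inj in auto)
    moreover have "(\<Prod>i\<in>UNIV. A $ i $ ?T p i) = (\<Prod>i\<in>UNIV. A $ h i $ ?T p (h i))"
      by (rule prod.reindex_bij_betw[OF h, symmetric])
    ultimately show "of_int (sign (?T p)) * (\<Prod>i\<in>UNIV. A $ i $ ?T p i)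
        = of_int (sign p) * (\<Prod>i\<in>UNIV. A $ h i $ h (p i))"
      by (simp add: map_permutation_apply[OF inj])
  qed
  finally show ?thesis
    by (simp add: det_def)
qed

lemma det_matrix_ordered:
  fixes D :: "real^'n::finite \<Rightarrow> real^'n"
  shows "det (matrix (to_ordered \<circ> D \<circ> of_ordered)) = det (matrix D)"
proof -
  have ax: "of_ordered (axis j 1) = (axis (Rep_ordered_index j) 1 :: real^'n)" for j
    by (auto simp: of_ordered_def axis_def vec_eq_iff Abs_ordered_index_inverse Rep_ordered_index_inverse)
  have "matrix (to_ordered \<circ> D \<circ> of_ordered)
      = (\<chi> i j. matrix D $ Rep_ordered_index i $ Rep_ordered_index j)"
    by (simp add: matrix_def ax to_ordered_def vec_eq_iff)
  then show ?thesis
    by (simp add: det_reindex[OF bij_Rep_ordered_index])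
qed

text \<open>Lebesgue measure is determined by the volume of boxes, and renaming coordinates maps boxes to
  boxes with the same edge lengths.\<close>
lemma lborel_distr_to_ordered:
  "distr lborel borel (to_ordered :: real^'n::finite \<Rightarrow> _) = lborel"
proof (rule lborel_eqI[symmetric])
  fix l u :: "real^('n ordered_index)"
  assume le: "\<And>b. b \<in> Basis \<Longrightarrow> l \<bullet> b \<le> u \<bullet> b"
  have le': "l $ i \<le> u $ i" for i
    using le[of "axis i 1"] by (simp add: inner_axis axis_in_Basis_iff)
  have m: "to_ordered \<in> borel \<rightarrow>\<^sub>M borel"
    by (intro borel_measurable_continuous_onI linear_continuous_on bounded_linear_to_ordered)
  have "to_ordered -` box l u = (box (of_ordered l) (of_ordered u) :: (real^'n) set)"
  proof (intro set_eqI iffI)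
    fix x :: "real^'n"
    assume "x \<in> to_ordered -` box l u"
    then have "l $ i < x $ Rep_ordered_index i \<and> x $ Rep_ordered_index i < u $ i" for i
      by (auto simp: mem_box_cart to_ordered_def)
    then show "x \<in> box (of_ordered l) (of_ordered u)"
      unfolding mem_box_cart of_ordered_def
      by (metis Abs_ordered_index_inverse UNIV_I vec_lambda_beta)
  next
    fix x :: "real^'n"
    assume "x \<in> box (of_ordered l) (of_ordered u)"
    then have "l $ Abs_ordered_index i < x $ i \<and> x $ i < u $ Abs_ordered_index i" for i
      by (auto simp: mem_box_cart of_ordered_def)
    then show "x \<in> to_ordered -` box l u"
      by (auto simp: mem_box_cart to_ordered_def) (metis Rep_ordered_index_inverse)+
  qed
  then have "emeasure (distr lborel borel to_ordered) (box l u)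
      = emeasure lborel (box (of_ordered l) (of_ordered u) :: (real^'n) set)"
    using m by (subst emeasure_distr) auto
  also have "\<dots> = (\<Prod>b\<in>Basis. (of_ordered u - of_ordered l :: real^'n) \<bullet> b)"
    using le' by (subst emeasure_lborel_box)
      (auto simp: Basis_vec_def inner_axis of_ordered_def)
  also have "(\<Prod>b\<in>Basis. (of_ordered u - of_ordered l :: real^'n) \<bullet> b)
      = (\<Prod>i\<in>UNIV. (of_ordered u - of_ordered l :: real^'n) $ i)"
    by (simp add: prod.reindex Basis_vec_def axis_eq_axis inj_on_def UNION_singleton_eq_range inner_axis)
  also have "\<dots> = (\<Prod>i\<in>UNIV. (u - l) $ i)"
    using prod.reindex_bij_betw[OF bij_Abs_ordered_index, of "\<lambda>i. (u - l) $ i"]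
    by (simp add: of_ordered_def)
  also have "\<dots> = (\<Prod>b\<in>Basis. (u - l) \<bullet> b)"
    by (simp add: prod.reindex Basis_vec_def axis_eq_axis inj_on_def UNION_singleton_eq_range inner_axis)
  finally show "emeasure (distr lborel borel to_ordered) (box l u) = ennreal (\<Prod>b\<in>Basis. (u - l) \<bullet> b)" .
qed auto

lemma measurable_to_ordered: "to_ordered \<in> lebesgue \<rightarrow>\<^sub>M (lebesgue :: (real^('n::finite ordered_index)) measure)"
  and lebesgue_distr_to_ordered:
    "distr lebesgue lebesgue (to_ordered :: real^'n \<Rightarrow> _) = lebesgue"
proof -
  let ?T = "to_ordered :: real^'n \<Rightarrow> _"
  have m: "?T \<in> lborel \<rightarrow>\<^sub>M borel"
    by (auto intro!: borel_measurable_continuous_onI linear_continuous_on bounded_linear_to_ordered)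
  have m': "?T \<in> lebesgue \<rightarrow>\<^sub>M borel"
    using m by (simp add: measurable_completion)
  have eq: "distr lebesgue lborel ?T = lborel"
    using lborel_distr_to_ordered[where 'n='n] m by (simp add: distr_completion cong: distr_cong)
  then have null: "null_sets lborel = null_sets (distr lebesgue lborel ?T)"
    by simp
  show "?T \<in> lebesgue \<rightarrow>\<^sub>M lebesgue"
    by (rule completion.measurable_completion2) (use m' eq in auto)
  have "lebesgue = completion (distr lebesgue lborel ?T)"
    by (simp add: eq)
  also have "\<dots> = distr lebesgue lebesgue ?T"
    by (subst completion.completion_distr_eq) (use m' eq in auto)
  finally show "distr lebesgue lebesgue ?T = lebesgue"
    by simp
qed

text \<open>Preimages are images under the inverse, a linear map between spaces of equal dimension, and such
  maps preserve Lebesgue measurability.\<close>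
lemma measurable_of_ordered:
  "(of_ordered :: _ \<Rightarrow> real^'n::finite) \<in> lebesgue \<rightarrow>\<^sub>M lebesgue"
proof (rule measurableI)
  fix X :: "(real^'n) set"
  assume X: "X \<in> sets lebesgue"
  have "of_ordered -` X = to_ordered ` X"
    by (auto simp: image_iff) (metis to_of_ordered)
  moreover have "to_ordered ` X \<in> sets lebesgue"
  proof (rule differentiable_image_in_sets_lebesgue[OF X])
    have "CARD('n) = CARD('n ordered_index)"
      by (rule bij_betw_same_card[OF bij_Abs_ordered_index])
    then show "DIM(real^'n) \<le> DIM(real^'n ordered_index)"
      by simp
  qed (simp add: linear_to_ordered linear_imp_differentiable_on)
  ultimately show "of_ordered -` X \<inter> space lebesgue \<in> sets lebesgue"
    by simp
qed auto

lemma integrable_to_ordered_iff: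
  fixes f :: "real^('n::finite ordered_index) \<Rightarrow> 'b::{banach, second_countable_topology}"
  shows "integrable lebesgue (\<lambda>x. f (to_ordered x)) \<longleftrightarrow> integrable lebesgue f" (is "?L \<longleftrightarrow> ?R")
    and "(LINT x|lebesgue. f (to_ordered x)) = (LINT x|lebesgue. f x)"
proof -
  have meas: "f \<in> borel_measurable lebesgue" if "(\<lambda>x. f (to_ordered x)) \<in> borel_measurable lebesgue"
    using measurable_compose[OF measurable_of_ordered that] by simp
  have iff: "integrable lebesgue (\<lambda>x. f (to_ordered x)) \<longleftrightarrow> integrable lebesgue f"
    if "f \<in> borel_measurable lebesgue"
    using integrable_distr_eq[OF measurable_to_ordered that] by (simp add: lebesgue_distr_to_ordered)
  show *: "?L \<longleftrightarrow> ?R"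
  proof
    assume ?L
    then show ?R
      using iff[OF meas] by (simp add: borel_measurable_integrable)
  next
    assume ?R
    then show ?L
      using iff by (simp add: borel_measurable_integrable)
  qed
  show "(LINT x|lebesgue. f (to_ordered x)) = (LINT x|lebesgue. f x)"
  proof (cases ?R)
    case True
    then have "f \<in> borel_measurable lebesgue"
      by simp
    from integral_distr[OF measurable_to_ordered this] show ?thesis
      by (simp add: lebesgue_distr_to_ordered)
  next
    case False
    then show ?thesis
      using * by (simp add: not_integrable_integral_eq)
  qed
qed

lemma set_integrable_to_ordered_iff:
  fixes f :: "real^('n::finite ordered_index) \<Rightarrow> 'b::{banach, second_countable_topology}"
  shows "set_integrable lebesgue (of_ordered ` S) (\<lambda>x. f (to_ordered x)) \<longleftrightarrow> set_integrable lebesgue S f"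
    and "(LINT x:of_ordered ` S|lebesgue. f (to_ordered x)) = (LINT x:S|lebesgue. f x)"
proof -
  have "indicator (of_ordered ` S) x = (indicator S (to_ordered x) :: real)" for x :: "real^'n"
    by (metis image_iff indicator_simps of_to_ordered to_of_ordered)
  then show "set_integrable lebesgue (of_ordered ` S) (\<lambda>x. f (to_ordered x)) \<longleftrightarrow> set_integrable lebesgue S f"
    and "(LINT x:of_ordered ` S|lebesgue. f (to_ordered x)) = (LINT x:S|lebesgue. f x)"
    using integrable_to_ordered_iff[of "\<lambda>x. indicator S x *\<^sub>R f x"]
    by (simp_all add: set_integrable_def set_lebesgue_integral_def)
qed

lemma absolutely_integrable_vec1_iff:
  fixes f :: "'a::euclidean_space \<Rightarrow> real"
  shows "(\<lambda>x. (\<chi> i. f x) :: real^1) absolutely_integrable_on S \<longleftrightarrow> f absolutely_integrable_on S"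
  using absolutely_integrable_on_1_iff[where f="\<lambda>x. (\<chi> i. f x) :: real^1" and S=S] by simp

text \<open>The formula for well-ordered index types, applied to \<open>g\<close> conjugated with the renaming of
  coordinates.  As that formula is about vector-valued integrands, the real integrand is viewed as
  a vector of length one.\<close>
theorem lebesgue_change_of_variables:
  fixes f :: "real^'n::finite \<Rightarrow> real" and g :: "real^'n \<Rightarrow> real^'n"
  assumes S: "S \<in> sets lebesgue"
    and der: "\<And>x. x \<in> S \<Longrightarrow> (g has_derivative g' x) (at x within S)"
    and inj: "inj_on g S"
  shows "set_integrable lebesgue (g ` S) f \<longleftrightarrow>
      set_integrable lebesgue S (\<lambda>x. \<bar>det (matrix (g' x))\<bar> * f (g x))" (is ?int)
    and "(LINT y:g ` S|lebesgue. f y) = (LINT x:S|lebesgue. \<bar>det (matrix (g' x))\<bar> * f (g x))" (is ?eq)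
proof -
  define T where "T = to_ordered ` S"
  define G where "G = to_ordered \<circ> g \<circ> of_ordered"
  define G' where "G' x = to_ordered \<circ> g' (of_ordered x) \<circ> of_ordered" for x
  define h where "h x = f (of_ordered x)" for x
  let ?h = "\<lambda>x. (\<chi> i. h x) :: real^1"
  let ?D = "\<lambda>x. \<bar>det (matrix (G' x))\<bar> * h (G x)"
  have S_eq: "of_ordered ` T = S"
    by (auto simp: T_def image_image)
  have "T = of_ordered -` S"
    by (auto simp: T_def image_iff) (metis to_of_ordered)
  then have T: "T \<in> sets lebesgue"
    using measurable_sets[OF measurable_of_ordered S] by simp
  have derG: "(G has_derivative G' x) (at x within T)" if "x \<in> T" for x
  proof -
    have "(g has_derivative g' (of_ordered x)) (at (of_ordered x) within of_ordered ` T)"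
      using der that S_eq by auto
    then show ?thesis
      unfolding G_def G'_def comp_assoc
      using diff_chain_within[OF diff_chain_within[OF bounded_linear_imp_has_derivative[OF bounded_linear_of_ordered]]
          bounded_linear_imp_has_derivative[OF bounded_linear_to_ordered]]
      by (simp add: comp_assoc)
  qed
  have injG: "inj_on G T"
    using inj by (auto simp: inj_on_def G_def T_def) (metis of_to_ordered)
  have Gim: "of_ordered ` (G ` T) = g ` S"
    by (auto simp: G_def T_def image_image)
  have iff: "(\<lambda>x. \<bar>det (matrix (G' x))\<bar> *\<^sub>R ?h (G x)) absolutely_integrable_on T \<and>
      integral T (\<lambda>x. \<bar>det (matrix (G' x))\<bar> *\<^sub>R ?h (G x)) = b
    \<longleftrightarrow> ?h absolutely_integrable_on (G ` T) \<and> integral (G ` T) ?h = b" for b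
    by (rule has_absolute_integral_change_of_variables[OF T derG injG])
  have scale: "(\<lambda>x. \<bar>det (matrix (G' x))\<bar> *\<^sub>R ?h (G x)) = (\<lambda>x. \<chi> i. ?D x)"
    by (auto simp: vec_eq_iff)
  have int: "h absolutely_integrable_on (G ` T) \<longleftrightarrow> ?D absolutely_integrable_on T"
    using iff unfolding scale absolutely_integrable_vec1_iff by blast
  have eq: "(LINT y:G ` T|lebesgue. h y) = (LINT x:T|lebesgue. ?D x)"
  proof (cases "h absolutely_integrable_on (G ` T)")
    case True
    with int have D: "?D absolutely_integrable_on T"
      by simp
    have "integral (G ` T) ?h = integral T (\<lambda>x. (\<chi> i. ?D x) :: real^1)"
      using iff True D unfolding scale absolutely_integrable_vec1_iff by blast
    moreover have "integral (G ` T) ?h $ 1 = integral (G ` T) h"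
      using True absolutely_integrable_vec1_iff[where f = h and S = "G ` T"]
      by (simp add: set_lebesgue_integral_eq_integral integral_component_eq_cart[symmetric])
    moreover have "integral T (\<lambda>x. (\<chi> i. ?D x) :: real^1) $ 1 = integral T ?D"
      using D absolutely_integrable_vec1_iff[where f = "?D" and S = T]
      by (simp add: set_lebesgue_integral_eq_integral integral_component_eq_cart[symmetric])
    ultimately show ?thesis
      using True D by (simp add: set_lebesgue_integral_eq_integral)
  next
    case False
    with int show ?thesis
      by (simp add: set_lebesgue_integral_def set_integrable_def not_integrable_integral_eq)
  qed
  have D_eq: "?D (to_ordered x) = \<bar>det (matrix (g' x))\<bar> * f (g x)" for x
    by (simp add: G'_def h_def G_def det_matrix_ordered)
  show ?int
    using int set_integrable_to_ordered_iff(1)[where S = "G ` T" and f = h] set_integrable_to_ordered_iff(1)[where S = T and f = "?D"]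
    unfolding Gim S_eq D_eq by (simp add: h_def)
  show ?eq
    using eq set_integrable_to_ordered_iff(2)[where S = "G ` T" and f = h] set_integrable_to_ordered_iff(2)[where S = T and f = "?D"]
    unfolding Gim S_eq D_eq by (simp add: h_def)
qed

section \<open>Mollification\<close>

lemma gradient_eqI:
  assumes "(\<phi> has_derivative (\<lambda>h. v \<bullet> h)) (at x)"
  shows "gradient \<phi> x = v"
  by (simp add: gradient_def vec_eq_iff inner_axis flip: frechet_derivative_at[OF assms])

lemma has_derivative_gradient:
  assumes "\<phi> differentiable (at x)"
  shows "(\<phi> has_derivative (\<lambda>h. gradient \<phi> x \<bullet> h)) (at x)"
proof -
  let ?D = "frechet_derivative \<phi> (at x)"
  have D: "(\<phi> has_derivative ?D) (at x)"
    using assms by (simp add: frechet_derivative_works)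
  then have lin: "linear ?D"
    by (simp add: has_derivative_linear)
  have "?D h = gradient \<phi> x \<bullet> h" for h
  proof -
    have "?D h = ?D (\<Sum>j\<in>UNIV. h $ j *\<^sub>R axis j 1)"
      using basis_expansion[of h] by (simp add: scalar_mult_eq_scaleR)
    also have "\<dots> = (\<Sum>j\<in>UNIV. h $ j * ?D (axis j 1))"
      by (simp add: linear_sum[OF lin] linear_cmul[OF lin])
    also have "\<dots> = gradient \<phi> x \<bullet> h"
      by (simp add: gradient_def inner_vec_def mult.commute)
    finally show ?thesis .
  qed
  then show ?thesis
    using D by presburger
qed

lemma integrable_continuous_compact_support:
  fixes f :: "'a::euclidean_space \<Rightarrow> 'b::{banach, second_countable_topology}"
  assumes "continuous_on UNIV f" "compact S" "\<And>x. x \<notin> S \<Longrightarrow> f x = 0"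
  shows "integrable lebesgue f"
proof -
  have "integrable lborel (\<lambda>x. indicator S x *\<^sub>R f x)"
    using assms continuous_on_subset by (intro borel_integrable_compact) blast+
  moreover have "(\<lambda>x. indicator S x *\<^sub>R f x) = f"
    using assms(3) by (auto simp: indicator_def)
  moreover have "f \<in> borel_measurable borel"
    using assms(1) by (rule borel_measurable_continuous_onI)
  ultimately show ?thesis
    by (simp add: integrable_completion)
qed

lemma lebesgue_integral_eq_integral_cbox:
  fixes f :: "'a::euclidean_space \<Rightarrow> 'b::euclidean_space"
  assumes "continuous_on UNIV f" "\<And>x. x \<notin> cbox a b \<Longrightarrow> f x = 0"
  shows "(LINT x|lebesgue. f x) = integral (cbox a b) f"
proof -
  have "integrable lebesgue f"
    using assms by (intro integrable_continuous_compact_support[of f "cbox a b"]) auto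
  moreover have *: "(\<lambda>x. indicator (cbox a b) x *\<^sub>R f x) = f"
    using assms(2) by (auto simp: indicator_def)
  ultimately have "set_integrable lebesgue (cbox a b) f"
    by (simp add: set_integrable_def)
  from set_lebesgue_integral_eq_integral(2)[OF this] * show ?thesis
    by (simp add: set_lebesgue_integral_def)
qed

lemma lebesgue_integral_translate:
  fixes f :: "'a::euclidean_space \<Rightarrow> real"
  assumes "f \<in> borel_measurable borel"
  shows "(LINT z|lebesgue. f (z - y)) = (LINT z|lebesgue. f z)"
proof -
  have "(LINT z|lborel. f z) = (LINT z|distr lborel borel ((+) (- y)). f z)"
    by (simp add: lborel_distr_plus)
  also have "\<dots> = (LINT z|lborel. f (z - y))"
    using assms by (subst integral_distr) auto
  finally show ?thesis
    using assms by (simp add: integral_completion)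
qed

text \<open>A radial bump supported in the ball of radius \<open>\<epsilon>\<close>.  The square makes it continuously
  differentiable across the boundary sphere, which is all that test functions require.\<close>
definition bump :: "real \<Rightarrow> real^'n \<Rightarrow> real" where
  "bump \<epsilon> x = (max 0 (\<epsilon>\<^sup>2 - x \<bullet> x))\<^sup>2"

definition bump_gradient :: "real \<Rightarrow> real^'n \<Rightarrow> real^'n" where
  "bump_gradient \<epsilon> x = (- 4 * max 0 (\<epsilon>\<^sup>2 - x \<bullet> x)) *\<^sub>R x"

lemma has_derivative_bump: "(bump \<epsilon> has_derivative (\<lambda>h. bump_gradient \<epsilon> x \<bullet> h)) (at x)"
proof -
  \<comment> \<open>The squared positive part is differentiable also at its kink.\<close>
  have sq: "((\<lambda>t::real. (max 0 t)\<^sup>2) has_real_derivative 2 * max 0 t) (at t)" for t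
  proof -
    consider "t < 0" | "t = 0" | "t > 0" by linarith
    then show ?thesis
    proof cases
      case 1
      show ?thesis
      proof (rule has_field_derivative_transform_within_open[of "\<lambda>_. 0" _ t "{..<0}"])
        show "((\<lambda>_. 0) has_real_derivative 2 * max 0 t) (at t)"
          using 1 by (auto intro!: derivative_eq_intros)
      qed (use 1 in auto)
    next
      case 2
      have "(\<lambda>h. (max 0 h)\<^sup>2 / h) \<midarrow>0\<rightarrow> (0::real)"
      proof (rule Lim_null_comparison)
        show "\<forall>\<^sub>F h in at 0. norm ((max 0 h)\<^sup>2 / h) \<le> \<bar>h\<bar>"
          by (rule eventuallyI) (auto simp: max_def power2_eq_square)
        show "(\<lambda>h::real. \<bar>h\<bar>) \<midarrow>0\<rightarrow> 0"
          by (rule tendsto_eq_intros | simp)+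
      qed
      then show ?thesis
        by (simp add: 2 DERIV_def)
    next
      case 3
      show ?thesis
      proof (rule has_field_derivative_transform_within_open[of "\<lambda>t. t\<^sup>2" _ t "{0<..}"])
        show "((\<lambda>t. t\<^sup>2) has_real_derivative 2 * max 0 t) (at t)"
          using 3 by (auto intro!: derivative_eq_intros)
      qed (use 3 in auto)
    qed
  qed
  have "((\<lambda>x. (max 0 (\<epsilon>\<^sup>2 - x \<bullet> x))\<^sup>2) has_derivative
      (\<lambda>h. (2 * max 0 (\<epsilon>\<^sup>2 - x \<bullet> x)) * (0 - (x \<bullet> h + h \<bullet> x)))) (at x)"
    by (rule has_derivative_compose[OF _ sq[unfolded has_field_derivative_def]])
      (intro derivative_intros)
  then show ?thesis
    by (simp add: bump_def[abs_def] bump_gradient_def inner_commute algebra_simps)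
qed

lemma bump_nonneg: "0 \<le> bump \<epsilon> x"
  by (simp add: bump_def)

lemma bump_minus: "bump \<epsilon> (x - y) = bump \<epsilon> (y - x)"
  by (simp add: bump_def inner_commute algebra_simps)

lemma bump_eq_0:
  assumes "\<epsilon> > 0" "norm x > \<epsilon>"
  shows "bump \<epsilon> x = 0" "bump_gradient \<epsilon> x = 0"
proof -
  have "\<epsilon>\<^sup>2 \<le> x \<bullet> x"
    using assms by (metis dot_square_norm less_eq_real_def power2_less_imp_less power_mono)
  then show "bump \<epsilon> x = 0" "bump_gradient \<epsilon> x = 0"
    by (simp_all add: bump_def bump_gradient_def)
qed

lemma continuous_bump: "continuous_on S (bump \<epsilon>)"
  and continuous_bump_gradient: "continuous_on S (bump_gradient \<epsilon>)"
  unfolding bump_def[abs_def] bump_gradient_def[abs_def] by (intro continuous_intros)+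

lemma borel_measurable_bump: "bump \<epsilon> \<in> borel_measurable borel"
  by (intro borel_measurable_continuous_onI continuous_bump)

lemma integrable_bump: "\<epsilon> > 0 \<Longrightarrow> integrable lebesgue (bump \<epsilon> :: real^'n::finite \<Rightarrow> real)"
  by (rule integrable_continuous_compact_support[where S = "cball 0 \<epsilon>"])
     (auto simp: continuous_bump bump_eq_0)

lemma integral_bump_pos:
  assumes "\<epsilon> > 0"
  shows "0 < (LINT x|lebesgue. bump \<epsilon> (x :: real^'n::finite))"
proof (rule ccontr)
  assume "\<not> ?thesis"
  then have "(LINT x|lebesgue. bump \<epsilon> (x :: real^'n)) = 0"
    by (metis bump_nonneg Bochner_Integration.integral_nonneg less_eq_real_def)
  then have "AE x in lebesgue. bump \<epsilon> (x :: real^'n) = 0"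
    using integral_nonneg_eq_0_iff_AE[OF integrable_bump[OF assms, where 'n='n]] by (simp add: bump_nonneg)
  then have "AE x in lebesgue. (x :: real^'n) \<notin> ball 0 \<epsilon>"
  proof (rule AE_mp, intro AE_I2 impI)
    fix x :: "real^'n"
    assume "bump \<epsilon> x = 0"
    then have "\<epsilon>\<^sup>2 \<le> (norm x)\<^sup>2"
      by (simp add: bump_def dot_square_norm max_def split: if_splits)
    then show "x \<notin> ball 0 \<epsilon>"
      using assms by (simp add: power2_le_iff_abs_le)
  qed
  then have "negligible (ball (0 :: real^'n) \<epsilon>)"
    by (simp add: AE_iff_null_sets negligible_iff_null_sets)
  then show False
    using assms open_not_negligible[of "ball (0 :: real^'n) \<epsilon>"] by simp
qed

definition mollifier :: "real \<Rightarrow> real^'n \<Rightarrow> real" where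
  "mollifier \<epsilon> x = bump \<epsilon> x / (LINT z|lebesgue. bump \<epsilon> (z :: real^'n))"

definition mollifier_gradient :: "real \<Rightarrow> real^'n \<Rightarrow> real^'n" where
  "mollifier_gradient \<epsilon> x = bump_gradient \<epsilon> x /\<^sub>R (LINT z|lebesgue. bump \<epsilon> (z :: real^'n))"

definition mollify :: "real \<Rightarrow> (real^'n \<Rightarrow> real) \<Rightarrow> real^'n \<Rightarrow> real" where
  "mollify \<epsilon> \<psi> y = (LINT z|lebesgue. mollifier \<epsilon> (y - z) * \<psi> z)"

lemma mollifier_nonneg: "0 \<le> mollifier \<epsilon> x"
  unfolding mollifier_def by (intro divide_nonneg_nonneg bump_nonneg integral_nonneg_AE) (simp add: bump_nonneg)

lemma mollifier_eq_0: "\<epsilon> > 0 \<Longrightarrow> norm x > \<epsilon> \<Longrightarrow> mollifier \<epsilon> x = 0"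
  by (simp add: mollifier_def bump_eq_0)

lemma continuous_mollifier [continuous_intros]:
  "continuous_on S f \<Longrightarrow> continuous_on S (\<lambda>x. mollifier \<epsilon> (f x))"
  unfolding mollifier_def divide_inverse
  by (intro continuous_intros continuous_on_compose2[OF continuous_bump[of UNIV]]) auto

lemma continuous_mollifier_gradient [continuous_intros]:
  "continuous_on S f \<Longrightarrow> continuous_on S (\<lambda>x. mollifier_gradient \<epsilon> (f x))"
  unfolding mollifier_gradient_def
  by (intro continuous_intros continuous_on_compose2[OF continuous_bump_gradient[of UNIV]]) auto

lemma has_derivative_mollifier:
  "(mollifier \<epsilon> has_derivative (\<lambda>h. mollifier_gradient \<epsilon> x \<bullet> h)) (at x)"
proof -
  have "((\<lambda>x. bump \<epsilon> x * inverse (LINT z|lebesgue. bump \<epsilon> (z :: real^'a))) has_derivative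
      (\<lambda>h. (bump_gradient \<epsilon> x \<bullet> h) * inverse (LINT z|lebesgue. bump \<epsilon> (z :: real^'a)))) (at x)"
    by (rule has_derivative_mult_left[OF has_derivative_bump])
  then show ?thesis
    by (simp add: mollifier_def[abs_def] mollifier_gradient_def divide_inverse mult.commute)
qed

lemma integrable_mollifier: "\<epsilon> > 0 \<Longrightarrow> integrable lebesgue (\<lambda>z. mollifier \<epsilon> (y - z))"
  by (rule integrable_continuous_compact_support[where S = "cball y \<epsilon>"])
     (auto intro!: continuous_intros mollifier_eq_0 simp: dist_norm)

lemma integral_mollifier:
  fixes y :: "real^'n::finite"
  assumes "\<epsilon> > 0"
  shows "(LINT z|lebesgue. mollifier \<epsilon> (y - z)) = 1"
proof -
  have "(LINT z|lebesgue. bump \<epsilon> (y - z)) = (LINT z|lebesgue. bump \<epsilon> (z :: real^'n))"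
    using lebesgue_integral_translate[OF borel_measurable_bump] by (simp add: bump_minus[of _ y])
  then show ?thesis
    using integral_bump_pos[OF assms, where 'n='n] by (simp add: mollifier_def)
qed

lemma integrable_mollify:
  assumes "\<epsilon> > 0" "continuous_on UNIV \<psi>"
  shows "integrable lebesgue (\<lambda>z. mollifier \<epsilon> (y - z) * \<psi> z)"
  using assms
  by (intro integrable_continuous_compact_support[where S = "cball y \<epsilon>"])
     (auto intro!: continuous_intros mollifier_eq_0 simp: dist_norm)

lemma mollify_eq_0:
  assumes "\<epsilon> > 0" "\<forall>z. z \<notin> S \<longrightarrow> \<psi> z = 0" "y \<notin> (\<Union>x\<in>S. \<Union>z\<in>cball 0 \<epsilon>. {x + z})"
  shows "mollify \<epsilon> \<psi> y = 0"
proof -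
  have "mollifier \<epsilon> (y - z) * \<psi> z = 0" for z
  proof (cases "z \<in> S")
    case True
    have "y - z \<notin> cball 0 \<epsilon>"
    proof
      assume "y - z \<in> cball 0 \<epsilon>"
      with True have "z + (y - z) \<in> (\<Union>x\<in>S. \<Union>z\<in>cball 0 \<epsilon>. {x + z})"
        by blast
      with assms(3) show False
        by simp
    qed
    then show ?thesis
      using assms(1) by (simp add: mollifier_eq_0)
  qed (simp add: assms(2))
  then show ?thesis
    unfolding mollify_def by (simp only: Bochner_Integration.integral_zero)
qed

text \<open>A mollification is a weighted mean over a ball of radius \<open>\<epsilon>\<close>, so it inherits every bound that
  holds throughout this ball.  With \<open>t = \<psi> y\<close> this gives convergence at points of continuity,
  with \<open>t = 0\<close> a uniform bound.\<close>
lemma mollify_dist_le: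
  fixes \<psi> :: "real^'n::finite \<Rightarrow> real"
  assumes \<epsilon>: "\<epsilon> > 0" and \<psi>: "continuous_on UNIV \<psi>"
    and le: "\<And>z. norm (y - z) \<le> \<epsilon> \<Longrightarrow> \<bar>\<psi> z - t\<bar> \<le> \<delta>"
  shows "\<bar>mollify \<epsilon> \<psi> y - t\<bar> \<le> \<delta>"
proof -
  let ?m = "\<lambda>z. mollifier \<epsilon> (y - z)"
  note int = integrable_mollify[OF \<epsilon> \<psi>] integrable_mollifier[OF \<epsilon>]
  have "mollify \<epsilon> \<psi> y - t = (LINT z|lebesgue. ?m z * \<psi> z - ?m z * t)"
    unfolding mollify_def
    by (subst Bochner_Integration.integral_diff)
      (simp_all only: int integrable_mult_left integral_mult_left_zero integral_mollifier[OF \<epsilon>] mult_1)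
  also have "\<bar>\<dots>\<bar> \<le> (LINT z|lebesgue. ?m z * \<delta>)"
  proof (rule Bochner_Integration.integral_norm_bound_integral[where 'a="real^'n" and 'b=real, unfolded real_norm_def])
    fix z :: "real^'n"
    show "\<bar>?m z * \<psi> z - ?m z * t\<bar> \<le> ?m z * \<delta>"
    proof (cases "norm (y - z) \<le> \<epsilon>")
      case True
      have "\<bar>?m z * \<psi> z - ?m z * t\<bar> = ?m z * \<bar>\<psi> z - t\<bar>"
        using mollifier_nonneg[of \<epsilon> "y - z"] by (simp add: abs_mult flip: right_diff_distrib)
      also have "\<dots> \<le> ?m z * \<delta>"
        using le[OF True] mollifier_nonneg by (intro mult_left_mono)
      finally show ?thesis .
    qed (simp add: mollifier_eq_0 \<epsilon>)
  next
    show "integrable lebesgue (\<lambda>z. ?m z * \<psi> z - ?m z * t)"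
      by (intro Bochner_Integration.integrable_diff int integrable_mult_left)
    show "integrable lebesgue (\<lambda>z. ?m z * \<delta>)"
      by (intro int integrable_mult_left)
  qed
  also have "\<dots> = \<delta>"
    by (simp add: integral_mollifier[OF \<epsilon>])
  finally show ?thesis .
qed

text \<open>Differentiation under the integral sign; since \<open>\<psi>\<close> has compact support, the integral may be taken
  over a fixed box.\<close>
lemma has_derivative_mollify:
  fixes \<psi> :: "real^'n::finite \<Rightarrow> real"
  assumes \<epsilon>: "\<epsilon> > 0" and \<psi>: "continuous_on UNIV \<psi>" and S: "compact S" "\<forall>z. z \<notin> S \<longrightarrow> \<psi> z = 0"
  shows "(mollify \<epsilon> \<psi> has_derivative
      (\<lambda>h. (\<chi> j. LINT z|lebesgue. \<psi> z * mollifier_gradient \<epsilon> (y - z) $ j) \<bullet> h)) (at y)"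
    and "continuous_on UNIV (\<lambda>y. \<chi> j. LINT z|lebesgue. \<psi> z * mollifier_gradient \<epsilon> (y - z) $ j)"
proof -
  obtain a b where ab: "S \<subseteq> cbox a b"
    using compact_imp_bounded[OF S(1)] by (metis bounded_subset_cbox_symmetric)
  have \<psi>0: "\<psi> z = 0" if "z \<notin> cbox a b" for z
    using S(2) that ab by auto
  note \<psi>' = continuous_on_compose2[OF \<psi>]
  have moll: "mollify \<epsilon> \<psi> = (\<lambda>y. integral (cbox a b) (\<lambda>z. mollifier \<epsilon> (y - z) * \<psi> z))"
    unfolding mollify_def[abs_def]
    by (intro ext lebesgue_integral_eq_integral_cbox) (auto intro!: continuous_intros \<psi> simp: \<psi>0)
  have comp: "(LINT z|lebesgue. \<psi> z * mollifier_gradient \<epsilon> (y - z) $ j)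
      = integral (cbox a b) (\<lambda>z. \<psi> z * mollifier_gradient \<epsilon> (y - z) $ j)" for y j
    by (intro lebesgue_integral_eq_integral_cbox) (auto intro!: continuous_intros \<psi> simp: \<psi>0)
  let ?D = "\<lambda>y z. \<psi> z *\<^sub>R blinfun_inner_left (mollifier_gradient \<epsilon> (y - z))"
  have contD: "continuous_on (UNIV \<times> cbox a b) (\<lambda>(y, z). ?D y z)"
    unfolding split_beta by (intro continuous_intros \<psi>' bounded_linear.continuous_on[OF bounded_linear_blinfun_inner_left]) auto
  have "((\<lambda>y. integral (cbox a b) (\<lambda>z. mollifier \<epsilon> (y - z) * \<psi> z)) has_derivative
      integral (cbox a b) (?D y)) (at y within UNIV)"
  proof (rule leibniz_rule[OF _ _ contD])
    fix y z :: "real^'n"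
    have "((\<lambda>y. mollifier \<epsilon> (y - z)) has_derivative (\<lambda>h. mollifier_gradient \<epsilon> (y - z) \<bullet> (h - 0))) (at y)"
      by (rule has_derivative_compose[OF _ has_derivative_mollifier]) (intro derivative_intros)
    from has_derivative_mult_left[OF this, of "\<psi> z"]
    show "((\<lambda>y. mollifier \<epsilon> (y - z) * \<psi> z) has_derivative blinfun_apply (?D y z)) (at y within UNIV)"
      by (simp add: blinfun.scaleR_left mult.commute inner_commute scaleR_blinfun.rep_eq)
  next
    show "(\<lambda>z. mollifier \<epsilon> (y - z) * \<psi> z) integrable_on cbox a b" for y
      by (intro integrable_continuous continuous_intros \<psi>') auto
  qed auto
  moreover have "blinfun_apply (integral (cbox a b) (?D y))
      = (\<lambda>h. (\<chi> j. LINT z|lebesgue. \<psi> z * mollifier_gradient \<epsilon> (y - z) $ j) \<bullet> h)"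
  proof
    fix h
    have int: "?D y integrable_on cbox a b"
      by (intro integrable_continuous continuous_intros \<psi>' bounded_linear.continuous_on[OF bounded_linear_blinfun_inner_left]) auto
    have intj: "(\<lambda>z. \<psi> z * mollifier_gradient \<epsilon> (y - z) $ j) integrable_on cbox a b" for j
      by (intro integrable_continuous continuous_intros \<psi>') auto
    have "blinfun_apply (integral (cbox a b) (?D y)) h = integral (cbox a b) (\<lambda>z. blinfun_apply (?D y z) h)"
      by (rule blinfun_apply_integral[OF int])
    also have "\<dots> = integral (cbox a b) (\<lambda>z. \<Sum>j\<in>UNIV. (\<psi> z * mollifier_gradient \<epsilon> (y - z) $ j) * h $ j)"
      by (simp add: blinfun.scaleR_left inner_vec_def sum_distrib_left mult_ac)
    also have "\<dots> = (\<Sum>j\<in>UNIV. integral (cbox a b) (\<lambda>z. (\<psi> z * mollifier_gradient \<epsilon> (y - z) $ j) * h $ j))"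
      by (intro integral_sum integrable_on_mult_left intj) auto
    also have "\<dots> = (\<chi> j. LINT z|lebesgue. \<psi> z * mollifier_gradient \<epsilon> (y - z) $ j) \<bullet> h"
      by (simp add: inner_vec_def comp)
    finally show "blinfun_apply (integral (cbox a b) (?D y)) h
      = (\<chi> j. LINT z|lebesgue. \<psi> z * mollifier_gradient \<epsilon> (y - z) $ j) \<bullet> h" .
  qed
  ultimately show "(mollify \<epsilon> \<psi> has_derivative
      (\<lambda>h. (\<chi> j. LINT z|lebesgue. \<psi> z * mollifier_gradient \<epsilon> (y - z) $ j) \<bullet> h)) (at y)"
    unfolding moll by (rule has_derivative_eq_rhs)
  show "continuous_on UNIV (\<lambda>y. \<chi> j. LINT z|lebesgue. \<psi> z * mollifier_gradient \<epsilon> (y - z) $ j)"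
    unfolding comp
    by (intro continuous_on_vec_lambda integral_continuous_on_param)
       (auto simp: split_beta intro!: continuous_intros \<psi>')
qed

lemma gradient_mollify:
  fixes \<psi> :: "real^'n::finite \<Rightarrow> real"
  assumes "\<epsilon> > 0" "continuous_on UNIV \<psi>" "compact S" "\<forall>z. z \<notin> S \<longrightarrow> \<psi> z = 0"
  shows "gradient (mollify \<epsilon> \<psi>) y = (\<chi> j. LINT z|lebesgue. \<psi> z * mollifier_gradient \<epsilon> (y - z) $ j)"
  by (rule gradient_eqI[OF has_derivative_mollify(1)[OF assms]])

lemma mollify_test_function:
  fixes \<psi> :: "real^'n::finite \<Rightarrow> real"
  assumes \<epsilon>: "\<epsilon> > 0" and \<psi>: "continuous_on UNIV \<psi>" and S: "compact S" "\<forall>z. z \<notin> S \<longrightarrow> \<psi> z = 0"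
    and sub: "(\<Union>x\<in>S. \<Union>z\<in>cball 0 \<epsilon>. {x + z}) \<subseteq> U"
  shows "mollify \<epsilon> \<psi> \<in> test_functions U"
proof -
  define N where "N = (\<Union>x\<in>S. \<Union>z\<in>cball 0 \<epsilon>. {x + z})"
  have N: "compact N"
    unfolding N_def by (rule compact_sums'[OF S(1) compact_cball])
  have "y \<in> N" if "mollify \<epsilon> \<psi> y \<noteq> 0" for y
    using mollify_eq_0[of \<epsilon> S \<psi> y, folded N_def, OF \<epsilon> S(2)] that by auto
  then have sub_N: "closure {x. mollify \<epsilon> \<psi> x \<noteq> 0} \<subseteq> N"
    using compact_imp_closed[OF N] by (intro closure_minimal) blast+
  then have "compact (closure {x. mollify \<epsilon> \<psi> x \<noteq> 0})"
    using compact_Int_closed[OF N closed_closure, of "{x. mollify \<epsilon> \<psi> x \<noteq> 0}"]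
    by (simp add: Int_absorb1)
  moreover have "mollify \<epsilon> \<psi> differentiable (at x)" for x
    by (rule differentiableI[OF has_derivative_mollify(1)[OF \<epsilon> \<psi> S]])
  moreover have "continuous_on UNIV (gradient (mollify \<epsilon> \<psi>))"
    using has_derivative_mollify(2)[OF \<epsilon> \<psi> S] by (simp add: gradient_mollify[OF \<epsilon> \<psi> S, abs_def])
  moreover have "closure {x. mollify \<epsilon> \<psi> x \<noteq> 0} \<subseteq> U"
    using sub_N sub unfolding N_def by (rule subset_trans)
  ultimately show ?thesis
    by (simp add: test_functions_def)
qed

lemma mollify_tendsto:
  fixes \<psi> :: "real^'n::finite \<Rightarrow> real"
  assumes \<psi>: "continuous_on UNIV \<psi>" and e: "\<And>k. e k > 0" "e \<longlonglongrightarrow> 0"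
  shows "(\<lambda>k. mollify (e k) \<psi> y) \<longlonglongrightarrow> \<psi> y"
proof (rule LIMSEQ_I)
  fix r :: real
  assume "r > 0"
  then obtain d where d: "d > 0" "\<And>z. dist z y < d \<Longrightarrow> dist (\<psi> z) (\<psi> y) < r / 2"
    using \<psi> unfolding continuous_on_iff by (metis UNIV_I half_gt_zero)
  obtain N where N: "\<And>k. k \<ge> N \<Longrightarrow> e k < d"
    using order_tendstoD(2)[OF e(2) \<open>d > 0\<close>] by (auto simp: eventually_sequentially)
  have "norm (mollify (e k) \<psi> y - \<psi> y) < r" if "k \<ge> N" for k
  proof -
    have "\<bar>mollify (e k) \<psi> y - \<psi> y\<bar> \<le> r / 2"
    proof (rule mollify_dist_le[OF e(1) \<psi>])
      fix z assume "norm (y - z) \<le> e k"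
      then have "dist z y < d"
        using N[OF that] by (simp add: dist_norm norm_minus_commute)
      then show "\<bar>\<psi> z - \<psi> y\<bar> \<le> r / 2"
        using d(2)[of z] by (simp add: dist_real_def)
    qed
    then show ?thesis
      using \<open>r > 0\<close> by simp
  qed
  then show "\<exists>N. \<forall>k\<ge>N. norm (mollify (e k) \<psi> y - \<psi> y) < r"
    by blast
qed

lemma mem_closed_neighbourhoodI:
  fixes x y :: "'a::real_normed_vector"
  assumes "y \<in> S" "norm (x - y) \<le> \<epsilon>"
  shows "x \<in> (\<Union>y\<in>S. \<Union>z\<in>cball 0 \<epsilon>. {y + z})"
proof -
  have "y + (x - y) \<in> (\<Union>y\<in>S. \<Union>z\<in>cball 0 \<epsilon>. {y + z})"
    using assms by (intro UN_I[of y] UN_I[of "x - y"]) auto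
  then show ?thesis
    by simp
qed

text \<open>The neighbourhood is written as a sum of sets, which makes its compactness immediate.\<close>
lemma compact_neighbourhood_in_open:
  fixes S U :: "(real^'n::finite) set"
  assumes "compact S" "S \<subseteq> U" "open U"
  obtains \<epsilon> where "\<epsilon> > 0" "(\<Union>x\<in>S. \<Union>z\<in>cball 0 \<epsilon>. {x + z}) \<subseteq> U"
proof -
  obtain \<epsilon> where \<epsilon>: "\<epsilon> > 0" "(\<Union>x\<in>S. cball x \<epsilon>) \<subseteq> U"
    by (rule compact_subset_open_imp_cball_epsilon_subset[OF assms(1,3,2)])
  have "(\<Union>x\<in>S. \<Union>z\<in>cball 0 \<epsilon>. {x + z}) \<subseteq> (\<Union>x\<in>S. cball x \<epsilon>)"
  proof (intro UN_least)
    fix x z :: "real^'n"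
    assume x: "x \<in> S" and "z \<in> cball 0 \<epsilon>"
    then have "x + z \<in> cball x \<epsilon>"
      by (simp add: dist_norm)
    then show "{x + z} \<subseteq> (\<Union>x\<in>S. cball x \<epsilon>)"
      using x by blast
  qed
  then show thesis
    by (intro that[OF \<epsilon>(1)] subset_trans[OF _ \<epsilon>(2)])
qed

lemma set_integrable_mult_continuous:
  fixes h q :: "real^'n::finite \<Rightarrow> real"
  assumes h: "set_integrable lebesgue S h" and S: "compact S" and q: "continuous_on S q"
  shows "set_integrable lebesgue S (\<lambda>x. q x * h x)"
proof (rule absolutely_integrable_bounded_measurable_product[OF bilinear_times _ _ _ h])
  show "S \<in> sets lebesgue"
    using S by (simp add: lmeasurable_compact fmeasurableD)
  then show "q \<in> borel_measurable (lebesgue_on S)"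
    using q by (intro continuous_imp_measurable_on_sets_lebesgue)
  show "bounded (q ` S)"
    using q S by (intro compact_imp_bounded compact_continuous_image)
qed

lemma set_integrable_mult_compact_support:
  fixes h \<psi> :: "real^'n::finite \<Rightarrow> real"
  assumes h: "locally_integrable U h" and \<psi>: "continuous_on UNIV \<psi>"
    and S: "compact S" "S \<subseteq> U" "\<forall>z. z \<notin> S \<longrightarrow> \<psi> z = 0"
  shows "set_integrable lebesgue U (\<lambda>x. h x * \<psi> x)"
proof -
  have "(\<lambda>x. indicator U x *\<^sub>R (h x * \<psi> x)) = (\<lambda>x. indicator S x *\<^sub>R (\<psi> x * h x))"
    using S(2,3) by (auto simp: indicator_def fun_eq_iff)
  moreover have "set_integrable lebesgue S (\<lambda>x. \<psi> x * h x)"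
    using h S(1,2) continuous_on_subset[OF \<psi>]
    by (intro set_integrable_mult_continuous) (auto simp: locally_integrable_def)
  ultimately show ?thesis
    by (simp add: set_integrable_def)
qed

lemma continuous_mollify:
  fixes \<psi> :: "real^'n::finite \<Rightarrow> real"
  assumes "\<epsilon> > 0" "continuous_on UNIV \<psi>" "compact S" "\<forall>z. z \<notin> S \<longrightarrow> \<psi> z = 0"
  shows "continuous_on T (mollify \<epsilon> \<psi>)"
  by (intro continuous_at_imp_continuous_on ballI has_derivative_continuous[OF has_derivative_mollify(1)[OF assms]])

text \<open>Dominated convergence: the mollifications converge pointwise, are bounded by the maximum of
  \<open>\<bar>\<psi>\<bar>\<close>, and vanish outside a fixed compact subset of \<open>U\<close>, on which \<open>h\<close> is integrable.\<close>
lemma integral_mollify_tendsto: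
  fixes h \<psi> :: "real^'n::finite \<Rightarrow> real"
  assumes h: "locally_integrable U h" and \<psi>: "continuous_on UNIV \<psi>"
    and S: "compact S" "\<forall>z. z \<notin> S \<longrightarrow> \<psi> z = 0"
    and \<epsilon>: "(\<Union>x\<in>S. \<Union>z\<in>cball 0 \<epsilon>. {x + z}) \<subseteq> U"
    and e: "\<And>k. 0 < e k" "\<And>k. e k \<le> \<epsilon>" "e \<longlonglongrightarrow> 0"
  shows "(\<lambda>k. LINT x:U|lebesgue. h x * mollify (e k) \<psi> x) \<longlonglongrightarrow> (LINT x:U|lebesgue. h x * \<psi> x)"
proof -
  define N where "N = (\<Union>x\<in>S. \<Union>z\<in>cball 0 \<epsilon>. {x + z})"
  have N: "compact N" "N \<subseteq> U"
    using \<epsilon> unfolding N_def by (auto intro!: compact_sums'[OF S(1) compact_cball])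
  have "\<epsilon> > 0"
    using e(1,2)[of 0] by simp
  have SN: "S \<subseteq> N"
    unfolding N_def using \<open>\<epsilon> > 0\<close> by (auto intro!: mem_closed_neighbourhoodI simp del: UN_iff)
  obtain M where M: "\<And>z. \<bar>\<psi> z\<bar> \<le> M"
  proof -
    have "bounded (\<psi> ` S)"
      using \<psi> S(1) by (intro compact_imp_bounded compact_continuous_image) (auto intro: continuous_on_subset)
    then obtain M where M: "\<forall>z\<in>S. \<bar>\<psi> z\<bar> \<le> M"
      by (auto simp: bounded_iff)
    have "\<bar>\<psi> z\<bar> \<le> max M 0" for z
      using M S(2) by (cases "z \<in> S") auto
    then show thesis
      by (rule that)
  qed
  have "M \<ge> 0"
    using M[of 0] by simp
  have vanish: "mollify (e k) \<psi> x = 0" if "x \<notin> N" for k x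
  proof (rule mollify_eq_0[OF e(1) S(2)])
    have "cball 0 (e k) \<subseteq> cball 0 \<epsilon>"
      using e(2) by (simp add: subset_cball)
    then show "x \<notin> (\<Union>x\<in>S. \<Union>z\<in>cball 0 (e k). {x + z})"
      using that unfolding N_def by blast
  qed
  have hN: "integrable lebesgue (\<lambda>x. indicator N x * h x)"
    using h N by (simp add: locally_integrable_def set_integrable_def)
  have "(\<lambda>k. LINT x|lebesgue. (indicator N x * h x) * mollify (e k) \<psi> x)
      \<longlonglongrightarrow> (LINT x|lebesgue. (indicator N x * h x) * \<psi> x)"
  proof (rule integral_dominated_convergence[where w = "\<lambda>x. M * \<bar>indicator N x * h x\<bar>"])
    have "\<psi> \<in> borel_measurable lebesgue"
      using \<psi> by (simp add: borel_measurable_continuous_onI measurable_completion)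
    then show "(\<lambda>x. indicator N x * h x * \<psi> x) \<in> borel_measurable lebesgue"
      using hN by measurable
    have "mollify (e k) \<psi> \<in> borel_measurable lebesgue" for k
      using continuous_mollify[OF e(1) \<psi> S] by (simp add: borel_measurable_continuous_onI measurable_completion)
    then show "(\<lambda>x. indicator N x * h x * mollify (e k) \<psi> x) \<in> borel_measurable lebesgue" for k
      using hN by measurable
    show "integrable lebesgue (\<lambda>x. M * \<bar>indicator N x * h x\<bar>)"
      using hN by (intro integrable_mult_right integrable_abs)
    show "AE x in lebesgue. (\<lambda>k. indicator N x * h x * mollify (e k) \<psi> x) \<longlonglongrightarrow> indicator N x * h x * \<psi> x"
      by (intro AE_I2 tendsto_mult_left mollify_tendsto[OF \<psi> e(1,3)])
    show "AE x in lebesgue. norm (indicator N x * h x * mollify (e k) \<psi> x) \<le> M * \<bar>indicator N x * h x\<bar>" for k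
    proof (rule AE_I2)
      fix x
      have "\<bar>mollify (e k) \<psi> x\<bar> \<le> M"
        using mollify_dist_le[OF e(1) \<psi>, of x k 0 M] M by simp
      then show "norm (indicator N x * h x * mollify (e k) \<psi> x) \<le> M * \<bar>indicator N x * h x\<bar>"
        by (simp add: abs_mult mult.commute mult_right_mono)
    qed
  qed
  moreover have "(LINT x|lebesgue. (indicator N x * h x) * mollify (e k) \<psi> x)
      = (LINT x:U|lebesgue. h x * mollify (e k) \<psi> x)" for k
    unfolding set_lebesgue_integral_def using vanish N(2)
    by (intro Bochner_Integration.integral_cong refl) (auto simp: indicator_def)
  moreover have "(LINT x|lebesgue. (indicator N x * h x) * \<psi> x) = (LINT x:U|lebesgue. h x * \<psi> x)"
    unfolding set_lebesgue_integral_def using SN S(2) N(2)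
    by (intro Bochner_Integration.integral_cong refl) (auto simp: indicator_def)
  ultimately show ?thesis
    by simp
qed

text \<open>The radii of the mollifications depend on the support \<open>S\<close> only, so one sequence serves several
  functions at once.\<close>
lemma mollifying_sequence:
  fixes S U :: "(real^'n::finite) set"
  assumes S: "compact S" "S \<subseteq> U" and U: "open U"
  obtains e where "\<And>k. 0 < e k"
    "\<And>\<psi> k. continuous_on UNIV \<psi> \<Longrightarrow> \<forall>z. z \<notin> S \<longrightarrow> \<psi> z = 0 \<Longrightarrow> mollify (e k) \<psi> \<in> test_functions U"
    "\<And>h \<psi>. locally_integrable U h \<Longrightarrow> continuous_on UNIV \<psi> \<Longrightarrow> \<forall>z. z \<notin> S \<longrightarrow> \<psi> z = 0 \<Longrightarrow>
      (\<lambda>k. LINT x:U|lebesgue. h x * mollify (e k) \<psi> x) \<longlonglongrightarrow> (LINT x:U|lebesgue. h x * \<psi> x)"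
proof -
  obtain \<epsilon> where \<epsilon>: "\<epsilon> > 0" "(\<Union>x\<in>S. \<Union>z\<in>cball 0 \<epsilon>. {x + z}) \<subseteq> U"
    using compact_neighbourhood_in_open[OF S U] by blast
  define e where "e k = \<epsilon> / real (Suc k)" for k
  have e: "0 < e k" "e k \<le> \<epsilon>" for k
    using \<epsilon>(1) by (auto simp: e_def divide_simps)
  have e0: "e \<longlonglongrightarrow> 0"
    unfolding e_def by (rule lim_const_over_n[THEN LIMSEQ_Suc])
  have sub: "(\<Union>x\<in>S. \<Union>z\<in>cball 0 (e k). {x + z}) \<subseteq> U" for k
  proof -
    have "cball 0 (e k) \<subseteq> cball 0 \<epsilon>"
      using e(2) by (simp add: subset_cball)
    then show ?thesis
      using \<epsilon>(2) by blast
  qed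
  show thesis
  proof (rule that[of e])
    fix h \<psi> :: "real^'n \<Rightarrow> real" and k
    assume \<psi>: "continuous_on UNIV \<psi>" "\<forall>z. z \<notin> S \<longrightarrow> \<psi> z = 0"
    show "mollify (e k) \<psi> \<in> test_functions U"
      by (rule mollify_test_function[OF e(1) \<psi>(1) S(1) \<psi>(2) sub])
    assume h: "locally_integrable U h"
    show "(\<lambda>k. LINT x:U|lebesgue. h x * mollify (e k) \<psi> x) \<longlonglongrightarrow> (LINT x:U|lebesgue. h x * \<psi> x)"
      by (rule integral_mollify_tendsto[OF h \<psi>(1) S(1) \<psi>(2) \<epsilon>(2) e e0])
  qed (rule e(1))
qed

lemma test_functionE:
  assumes "\<phi> \<in> test_functions U"
  obtains S where "compact S" "S \<subseteq> U" "\<forall>z. z \<notin> S \<longrightarrow> \<phi> z = 0" "\<forall>z. z \<notin> S \<longrightarrow> gradient \<phi> z = 0"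
    "continuous_on UNIV \<phi>" "continuous_on UNIV (gradient \<phi>)" "\<And>x. (\<phi> has_derivative (\<lambda>h. gradient \<phi> x \<bullet> h)) (at x)"
proof -
  define S where "S = closure {x. \<phi> x \<noteq> 0}"
  have S: "compact S" "S \<subseteq> U" "continuous_on UNIV (gradient \<phi>)"
    using assms by (auto simp: test_functions_def S_def)
  have der: "(\<phi> has_derivative (\<lambda>h. gradient \<phi> x \<bullet> h)) (at x)" for x
    using assms by (intro has_derivative_gradient) (simp add: test_functions_def)
  have cont: "continuous_on UNIV \<phi>"
    by (intro continuous_at_imp_continuous_on ballI has_derivative_continuous[OF der])
  have 0: "\<forall>z. z \<notin> S \<longrightarrow> \<phi> z = 0"
    unfolding S_def using subsetD[OF closure_subset, of _ "{x. \<phi> x \<noteq> 0}"] by (metis mem_Collect_eq)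
  have 1: "\<forall>z. z \<notin> S \<longrightarrow> gradient \<phi> z = 0"
  proof (intro allI impI)
    fix z assume "z \<notin> S"
    then have "((\<lambda>_. 0) has_derivative (\<lambda>h. gradient \<phi> z \<bullet> h)) (at z)"
      using 0 by (intro has_derivative_transform_within_open[OF der, of "- S"])
        (auto simp: open_Compl compact_imp_closed S(1))
    then have "(\<lambda>h. gradient \<phi> z \<bullet> h) = (\<lambda>_. 0)"
      by (rule has_derivative_unique[OF _ has_derivative_const])
    from fun_cong[OF this, of "gradient \<phi> z"] show "gradient \<phi> z = 0"
      by simp
  qed
  show thesis
    by (rule that[OF S(1,2) 0 1 cont S(3) der])
qed

section \<open>The fundamental lemma and the uniqueness of weak gradients\<close>

text \<open>Mollification extends the hypothesis from test functions to all continuous functions with compact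
  support in \<open>U\<close>.  Such functions decrease to the indicator of \<open>K\<close>.\<close>
lemma integral_compact_eq_0:
  fixes h :: "real^'n::finite \<Rightarrow> real"
  assumes U: "open U" and h: "locally_integrable U h"
    and test: "\<And>\<phi>. \<phi> \<in> test_functions U \<Longrightarrow> (LINT x:U|lebesgue. h x * \<phi> x) = 0"
    and K: "compact K" "K \<subseteq> U"
  shows "(LINT x:K|lebesgue. h x) = 0"
proof (cases "K = {}")
  case False
  have cont: "(LINT x:U|lebesgue. h x * \<psi> x) = 0"
    if \<psi>: "continuous_on UNIV \<psi>" and S: "compact S" "S \<subseteq> U" "\<forall>z. z \<notin> S \<longrightarrow> \<psi> z = 0" for \<psi> S
  proof -
    obtain e where test_e: "\<And>\<psi> k. continuous_on UNIV \<psi> \<Longrightarrow> \<forall>z. z \<notin> S \<longrightarrow> \<psi> z = 0 \<Longrightarrow>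
        mollify (e k) \<psi> \<in> test_functions U"
      and lim: "\<And>h \<psi>. locally_integrable U h \<Longrightarrow> continuous_on UNIV \<psi> \<Longrightarrow> \<forall>z. z \<notin> S \<longrightarrow> \<psi> z = 0 \<Longrightarrow>
        (\<lambda>k. LINT x:U|lebesgue. h x * mollify (e k) \<psi> x) \<longlonglongrightarrow> (LINT x:U|lebesgue. h x * \<psi> x)"
      by (rule mollifying_sequence[OF S(1,2) U]) (rule that)
    show ?thesis
      using lim[OF h \<psi> S(3)] by (simp add: test[OF test_e[OF \<psi> S(3)]] LIMSEQ_const_iff)
  qed
  obtain \<epsilon> where \<epsilon>: "\<epsilon> > 0" "(\<Union>x\<in>K. \<Union>z\<in>cball 0 \<epsilon>. {x + z}) \<subseteq> U"
    using compact_neighbourhood_in_open[OF K U] by blast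
  define N where "N = (\<Union>x\<in>K. \<Union>z\<in>cball 0 \<epsilon>. {x + z})"
  have N: "compact N" "N \<subseteq> U"
    using \<epsilon>(2) unfolding N_def by (auto intro!: compact_sums'[OF K(1) compact_cball])
  \<comment> \<open>Equal to one on \<open>K\<close>, and vanishing at distance \<open>\<epsilon> / (k + 1)\<close> from \<open>K\<close>.\<close>
  define \<psi> where "\<psi> k x = max 0 (1 - real (Suc k) / \<epsilon> * infdist x K)" for k x
  have vanish: "\<psi> k x = 0" if "x \<notin> N" for k x
  proof -
    have "\<epsilon> \<le> infdist x K"
    proof (rule ccontr)
      assume "\<not> \<epsilon> \<le> infdist x K"
      moreover obtain y where y: "y \<in> K" "infdist x K = dist x y"
        using infdist_attains_inf[OF compact_imp_closed[OF K(1)] False] by metis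
      ultimately have "x \<in> N"
        unfolding N_def by (intro mem_closed_neighbourhoodI[OF y(1)]) (simp add: dist_norm)
      then show False
        using that by simp
    qed
    then have "1 \<le> infdist x K / \<epsilon>"
      using \<epsilon>(1) by simp
    also have "\<dots> \<le> real (Suc k) * (infdist x K / \<epsilon>)"
      using \<epsilon>(1) infdist_nonneg[of x K] mult_right_mono[of 1 "real (Suc k)" "infdist x K / \<epsilon>"] by simp
    finally have "1 - real (Suc k) / \<epsilon> * infdist x K \<le> 0"
      by simp
    then show ?thesis
      unfolding \<psi>_def by (rule max_absorb1)
  qed
  have cont_\<psi>: "continuous_on UNIV (\<psi> k)" for k
    unfolding \<psi>_def by (intro continuous_intros)
  have hN: "integrable lebesgue (\<lambda>x. indicator N x * h x)"
    using h N by (simp add: locally_integrable_def set_integrable_def)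
  have KN: "x \<in> N" if "x \<in> K" for x
    unfolding N_def using \<epsilon>(1) by (intro mem_closed_neighbourhoodI[OF that]) simp
  have "(\<lambda>k. LINT x|lebesgue. (indicator N x * h x) * \<psi> k x)
      \<longlonglongrightarrow> (LINT x|lebesgue. (indicator N x * h x) * indicator K x)"
  proof (rule integral_dominated_convergence[where w = "\<lambda>x. \<bar>indicator N x * h x\<bar>"])
    have "K \<in> sets lebesgue"
      using K(1) by (simp add: lmeasurable_compact fmeasurableD)
    then show "(\<lambda>x. indicator N x * h x * indicator K x) \<in> borel_measurable lebesgue"
      using hN by measurable
    have "\<psi> k \<in> borel_measurable lebesgue" for k
      using cont_\<psi> by (simp add: borel_measurable_continuous_onI measurable_completion)
    then show "(\<lambda>x. indicator N x * h x * \<psi> k x) \<in> borel_measurable lebesgue" for k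
      using hN by measurable
    show "integrable lebesgue (\<lambda>x. \<bar>indicator N x * h x\<bar>)"
      using hN by (intro integrable_abs)
    show "AE x in lebesgue. (\<lambda>k. indicator N x * h x * \<psi> k x) \<longlonglongrightarrow> indicator N x * h x * indicator K x"
    proof (intro AE_I2 tendsto_mult_left)
      fix x
      show "(\<lambda>k. \<psi> k x) \<longlonglongrightarrow> indicator K x"
      proof (cases "x \<in> K")
        case True
        then show ?thesis
          by (simp add: \<psi>_def)
      next
        case x: False
        then have "infdist x K > 0"
          using in_closed_iff_infdist_zero[OF compact_imp_closed[OF K(1)] False]
          by (metis infdist_nonneg less_eq_real_def)
        then obtain n where n: "\<epsilon> / infdist x K \<le> real n"
          using real_arch_simple by blast
        have "\<psi> k x = 0" if "k \<ge> n" for k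
        proof -
          have "\<epsilon> / infdist x K \<le> real (Suc k)"
            using n that by linarith
          then have "1 \<le> real (Suc k) / \<epsilon> * infdist x K"
            using \<open>infdist x K > 0\<close> \<epsilon>(1) by (simp add: field_simps)
          then show ?thesis
            by (simp add: \<psi>_def)
        qed
        then have "\<forall>\<^sub>F k in sequentially. \<psi> k x = indicator K x"
          using x by (auto simp: eventually_sequentially)
        then show ?thesis
          by (rule tendsto_eventually)
      qed
    qed
    show "AE x in lebesgue. norm (indicator N x * h x * \<psi> k x) \<le> \<bar>indicator N x * h x\<bar>" for k
    proof (rule AE_I2)
      fix x
      have "\<bar>\<psi> k x\<bar> \<le> 1"
        using \<epsilon>(1) infdist_nonneg[of x K] by (simp add: \<psi>_def max_def)
      then show "norm (indicator N x * h x * \<psi> k x) \<le> \<bar>indicator N x * h x\<bar>"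
        by (simp add: abs_mult mult_left_le)
    qed
  qed
  moreover have "(LINT x|lebesgue. (indicator N x * h x) * \<psi> k x) = 0" for k
  proof -
    have "(LINT x|lebesgue. (indicator N x * h x) * \<psi> k x) = (LINT x:U|lebesgue. h x * \<psi> k x)"
      unfolding set_lebesgue_integral_def using vanish N(2)
      by (intro Bochner_Integration.integral_cong refl) (auto simp: indicator_def)
    then show ?thesis
      using cont[OF cont_\<psi> N] vanish by simp
  qed
  moreover have "(LINT x|lebesgue. (indicator N x * h x) * indicator K x) = (LINT x:K|lebesgue. h x)"
    unfolding set_lebesgue_integral_def using KN
    by (intro Bochner_Integration.integral_cong refl) (auto simp: indicator_def)
  ultimately show ?thesis
    by (simp add: LIMSEQ_const_iff)
qed (simp add: set_lebesgue_integral_def)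

text \<open>Otherwise inner regularity would provide a compact subset of positive measure on which \<open>h\<close> is
  positive, contradicting that the integral of \<open>h\<close> over it vanishes.\<close>
lemma positive_set_null:
  fixes h :: "real^'n::finite \<Rightarrow> real"
  assumes U: "open U" and h: "locally_integrable U h"
    and test: "\<And>\<phi>. \<phi> \<in> test_functions U \<Longrightarrow> (LINT x:U|lebesgue. h x * \<phi> x) = 0"
    and K: "compact K" "K \<subseteq> U"
  shows "{x \<in> K. 0 < h x} \<in> null_sets lebesgue"
proof -
  define P where "P = {x \<in> K. 0 < h x}"
  have int: "integrable lebesgue (\<lambda>x. indicator K x * h x)"
    using h K by (simp add: locally_integrable_def set_integrable_def)
  have "P = {x \<in> space lebesgue. 0 < indicator K x * h x}"
    by (auto simp: P_def indicator_def)
  also have "\<dots> \<in> sets lebesgue"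
    using int by measurable
  finally have P: "P \<in> sets lebesgue" .
  have "emeasure lebesgue P \<le> 0"
  proof (rule ennreal_le_epsilon)
    fix e :: real
    assume "0 < e"
    then obtain T where T: "closed T" "T \<subseteq> P" "P - T \<in> lmeasurable" "emeasure lebesgue (P - T) < ennreal e"
      using sets_lebesgue_inner_closed[OF P] by metis
    have "K \<inter> T = T"
      using T(2) by (auto simp: P_def)
    then have cT: "compact T"
      using compact_Int_closed[OF K(1) T(1)] by simp
    have TU: "T \<subseteq> U"
      using T(2) K(2) by (auto simp: P_def)
    have intT: "integrable lebesgue (\<lambda>x. indicator T x * h x)"
      using h cT TU by (simp add: locally_integrable_def set_integrable_def)
    have nonneg: "0 \<le> indicator T x * h x" for x
      using T(2) by (auto simp: P_def indicator_def)
    have "(LINT x|lebesgue. indicator T x * h x) = 0"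
      using integral_compact_eq_0[OF U h test cT TU] by (simp add: set_lebesgue_integral_def)
    then have "AE x in lebesgue. indicator T x * h x = 0"
      using integral_nonneg_eq_0_iff_AE[OF intT] nonneg by simp
    then have "AE x in lebesgue. x \<notin> T"
      by eventually_elim (use T(2) in \<open>auto simp: P_def indicator_def split: if_splits\<close>)
    then have T0: "emeasure lebesgue T = 0"
      using T(1) by (simp add: AE_iff_null_sets null_setsD1)
    have "emeasure lebesgue P \<le> emeasure lebesgue T + emeasure lebesgue (P - T)"
      using emeasure_subadditive[of T lebesgue "P - T"] T(1-3) by (simp add: fmeasurableD Un_absorb1)
    then show "emeasure lebesgue P \<le> 0 + ennreal e"
      using T(4) T0 by simp
  qed
  then show ?thesis
    using P unfolding P_def by (simp add: null_setsI)
qed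

lemma open_sigma_compact:
  fixes U :: "'a::euclidean_space set"
  assumes "open U"
  shows "\<exists>C :: nat \<Rightarrow> 'a set. (\<forall>n. compact (C n) \<and> C n \<subseteq> U) \<and> \<Union>(range C) = U"
  by (rule open_Union_compact_subsets[OF assms]) (intro exI conjI allI; assumption)

text \<open>The set where \<open>h\<close> is positive is null within each member of a compact exhaustion of \<open>U\<close>.  The
  hypotheses are invariant under \<open>h \<mapsto> - h\<close>, so the set where \<open>h\<close> is negative is null as well.\<close>
lemma fundamental_lemma_of_variations:
  fixes h :: "real^'n::finite \<Rightarrow> real"
  assumes U: "open U" and h: "locally_integrable U h"
    and test: "\<And>\<phi>. \<phi> \<in> test_functions U \<Longrightarrow> (LINT x:U|lebesgue. h x * \<phi> x) = 0"
  shows "AE x in lebesgue. x \<in> U \<longrightarrow> h x = 0"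
proof -
  obtain C :: "nat \<Rightarrow> (real^'n) set" where C: "\<And>n. compact (C n)" "\<And>n. C n \<subseteq> U" "\<Union>(range C) = U"
    using open_sigma_compact[OF U] by metis
  have h': "locally_integrable U (\<lambda>x. - h x)"
    using h by (simp add: locally_integrable_def set_integrable_def)
  have test': "(LINT x:U|lebesgue. - h x * \<phi> x) = 0" if "\<phi> \<in> test_functions U" for \<phi>
    using test[OF that] by (simp add: set_lebesgue_integral_def)
  have "AE x in lebesgue. \<forall>n. x \<notin> {x \<in> C n. 0 < h x}"
    by (simp only: AE_all_countable) (intro allI AE_not_in positive_set_null[OF U h test C(1,2)])
  moreover have "AE x in lebesgue. \<forall>n. x \<notin> {x \<in> C n. 0 < - h x}"
    by (simp only: AE_all_countable) (intro allI AE_not_in positive_set_null[OF U h' test' C(1,2)])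
  ultimately show ?thesis
  proof eventually_elim
    case (elim x)
    show ?case
    proof
      assume "x \<in> U"
      then obtain n where "x \<in> C n"
        using C(3) by blast
      with elim have "\<not> 0 < h x" "\<not> 0 < - h x"
        by blast+
      then show "h x = 0"
        by simp
    qed
  qed
qed

lemma locally_integrable_component:
  fixes g :: "real^'n::finite \<Rightarrow> real^'m::finite"
  assumes "locally_integrable U g"
  shows "locally_integrable U (\<lambda>x. g x $ j)"
  unfolding locally_integrable_def
proof (intro allI impI)
  fix S :: "(real^'n) set"
  assume "compact S \<and> S \<subseteq> U"
  then have "integrable lebesgue (\<lambda>x. indicator S x *\<^sub>R g x)"
    using assms by (simp add: locally_integrable_def set_integrable_def)
  from integrable_bounded_linear[OF bounded_linear_vec_nth this, of j]
  show "set_integrable lebesgue S (\<lambda>x. g x $ j)"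
    by (simp add: set_integrable_def)
qed

lemma borel_measurable_locally_integrable:
  fixes f :: "real^'n::finite \<Rightarrow> 'b::{banach, second_countable_topology}"
  assumes U: "open U" and f: "locally_integrable U f"
  shows "f \<in> borel_measurable (lebesgue_on U)"
proof -
  obtain C :: "nat \<Rightarrow> (real^'n) set" where C: "\<And>n. compact (C n)" "\<And>n. C n \<subseteq> U" "\<Union>(range C) = U"
    using open_sigma_compact[OF U] by metis
  have meas: "C n \<in> sets lebesgue" for n
    using C(1) by (simp add: lmeasurable_compact fmeasurableD)
  show ?thesis
  proof (rule measurable_piecewise_restrict[of "range C"])
    show "space (lebesgue_on U) \<subseteq> \<Union> (range C)"
      using C(3) by simp
    fix A assume "A \<in> range C"
    then obtain n where A: "A = C n" by blast
    have "A \<inter> U \<in> sets lebesgue"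
      using A meas U by auto
    then show "A \<inter> space (lebesgue_on U) \<in> sets (lebesgue_on U)"
      using U by (auto simp: sets_restrict_space_iff)
    have "set_integrable lebesgue (C n) f"
      using f C by (simp add: locally_integrable_def)
    then have "f \<in> borel_measurable (lebesgue_on (C n))"
      unfolding set_integrable_def
      by (subst borel_measurable_restrict_space_iff) (use meas in auto)
    moreover have "restrict_space (lebesgue_on U) A = lebesgue_on (C n)"
      using C(2)[of n] U meas unfolding A by (subst restrict_restrict_space) (auto simp: Int_absorb1 Int_absorb2)
    ultimately show "f \<in> borel_measurable (restrict_space (lebesgue_on U) A)"
      by simp
  qed auto
qed

lemma weak_gradient_unique:
  fixes g g' :: "real^'n::finite \<Rightarrow> real^'n"
  assumes U: "open U" and g: "has_weak_gradient U f g" and g': "has_weak_gradient U f g'"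
  shows "AE x in lebesgue. x \<in> U \<longrightarrow> g x = g' x"
proof -
  have "AE x in lebesgue. x \<in> U \<longrightarrow> g x $ j - g' x $ j = 0" for j
  proof (rule fundamental_lemma_of_variations[OF U])
    have loc: "locally_integrable U (\<lambda>x. g x $ j)" "locally_integrable U (\<lambda>x. g' x $ j)"
      using g g' by (auto simp: has_weak_gradient_def intro!: locally_integrable_component)
    then show "locally_integrable U (\<lambda>x. g x $ j - g' x $ j)"
      by (simp add: locally_integrable_def)
    fix \<phi> :: "real^'n \<Rightarrow> real"
    assume \<phi>: "\<phi> \<in> test_functions U"
    from \<phi> obtain S where S: "compact S" "S \<subseteq> U" "\<forall>z. z \<notin> S \<longrightarrow> \<phi> z = 0" "continuous_on UNIV \<phi>"
      by (rule test_functionE)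
    have "(LINT x:U|lebesgue. f x * gradient \<phi> x $ j) = - (LINT x:U|lebesgue. g x $ j * \<phi> x)"
      "(LINT x:U|lebesgue. f x * gradient \<phi> x $ j) = - (LINT x:U|lebesgue. g' x $ j * \<phi> x)"
      using g g' \<phi> by (simp_all add: has_weak_gradient_def)
    then have "(LINT x:U|lebesgue. g x $ j * \<phi> x) = (LINT x:U|lebesgue. g' x $ j * \<phi> x)"
      by simp
    then show "(LINT x:U|lebesgue. (g x $ j - g' x $ j) * \<phi> x) = 0"
      using set_integrable_mult_compact_support[OF loc(1) S(4,1,2,3)]
        set_integrable_mult_compact_support[OF loc(2) S(4,1,2,3)]
      by (simp add: left_diff_distrib set_integral_diff)
  qed
  then have "\<forall>j. AE x in lebesgue. x \<in> U \<longrightarrow> g x $ j - g' x $ j = 0"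
    by blast
  then have "AE x in lebesgue. \<forall>j. x \<in> U \<longrightarrow> g x $ j - g' x $ j = 0"
    by (rule AE_all_countable[THEN iffD2])
  then show ?thesis
    by eventually_elim (auto simp: vec_eq_iff)
qed

section \<open>Weak gradients tested against continuous fields\<close>

lemma integral_sum_mult_compact_support:
  fixes h :: "real^'n::finite \<Rightarrow> 'm::finite \<Rightarrow> real" and \<psi> :: "'m \<Rightarrow> real^'n \<Rightarrow> real"
  assumes "\<And>i. locally_integrable U (\<lambda>x. h x i)" "\<And>i. continuous_on UNIV (\<psi> i)"
    and "\<And>i. \<exists>S. compact S \<and> S \<subseteq> U \<and> (\<forall>z. z \<notin> S \<longrightarrow> \<psi> i z = 0)"
  shows "(LINT x:U|lebesgue. \<Sum>i\<in>UNIV. h x i * \<psi> i x) = (\<Sum>i\<in>UNIV. LINT x:U|lebesgue. h x i * \<psi> i x)"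
proof -
  have "integrable lebesgue (\<lambda>x. indicator U x *\<^sub>R (h x i * \<psi> i x))" for i
    using set_integrable_mult_compact_support[OF assms(1,2)] assms(3)[of i]
    unfolding set_integrable_def by blast
  then have "(LINT x|lebesgue. (\<Sum>i\<in>UNIV. indicator U x *\<^sub>R (h x i * \<psi> i x)))
      = (\<Sum>i\<in>UNIV. LINT x|lebesgue. indicator U x *\<^sub>R (h x i * \<psi> i x))"
    by (intro Bochner_Integration.integral_sum)
  then show ?thesis
    by (simp add: set_lebesgue_integral_def sum_distrib_left)
qed

text \<open>The functions \<open>\<zeta>\<close> range over all continuously differentiable functions; the integrals are finite
  through the compact support of \<open>\<Psi>\<close> and \<open>w\<close> in every application.\<close>
definition has_weak_divergence :: "('n \<Rightarrow> real^'n \<Rightarrow> real) \<Rightarrow> (real^'n \<Rightarrow> real) \<Rightarrow> bool" where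
  "has_weak_divergence \<Psi> w \<longleftrightarrow>
     (\<forall>\<zeta> X. (\<forall>x. (\<zeta> has_derivative (\<lambda>h. X x \<bullet> h)) (at x)) \<and> continuous_on UNIV X \<longrightarrow>
       (LINT y|lebesgue. (\<Sum>i\<in>UNIV. \<Psi> i y * X y $ i)) = - (LINT y|lebesgue. w y * \<zeta> y))"

lemma has_weak_divergenceD:
  assumes "has_weak_divergence \<Psi> w" "\<forall>x. (\<zeta> has_derivative (\<lambda>h. X x \<bullet> h)) (at x)" "continuous_on UNIV X"
  shows "(LINT y|lebesgue. (\<Sum>i\<in>UNIV. \<Psi> i y * X y $ i)) = - (LINT y|lebesgue. w y * \<zeta> y)"
  using assms(1)[unfolded has_weak_divergence_def, THEN spec[of _ \<zeta>], THEN spec[of _ X]] conjI[OF assms(2,3)]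
  by (rule mp)

text \<open>Differentiating \<open>\<integral> \<Psi>\<^sub>i z \<eta> (y - z) dz\<close> in \<open>y\<close> puts the derivative on the mollifier \<open>\<eta>\<close>.  Up to sign
  this is a derivative in \<open>z\<close>, so the weak divergence, tested with \<open>z \<mapsto> \<eta> (y - z)\<close>,
  moves it to \<open>\<Psi>\<close>: mollification commutes with the divergence.\<close>
lemma sum_gradient_mollify:
  fixes \<Psi> :: "'n::finite \<Rightarrow> real^'n \<Rightarrow> real"
  assumes \<epsilon>: "\<epsilon> > 0" and S: "compact S"
    and \<Psi>: "\<And>i. continuous_on UNIV (\<Psi> i)" "\<forall>i z. z \<notin> S \<longrightarrow> \<Psi> i z = 0"
    and div: "has_weak_divergence \<Psi> w"
  shows "(\<Sum>i\<in>UNIV. gradient (mollify \<epsilon> (\<Psi> i)) y $ i) = mollify \<epsilon> w y"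
proof -
  let ?X = "\<lambda>z. - mollifier_gradient \<epsilon> (y - z)"
  have "gradient (mollify \<epsilon> (\<Psi> i)) y $ i = (LINT z|lebesgue. \<Psi> i z * mollifier_gradient \<epsilon> (y - z) $ i)" for i
    using gradient_mollify[OF \<epsilon> \<Psi>(1) S, of i y] \<Psi>(2) by simp
  then have "(\<Sum>i\<in>UNIV. gradient (mollify \<epsilon> (\<Psi> i)) y $ i)
      = (\<Sum>i\<in>UNIV. LINT z|lebesgue. \<Psi> i z * mollifier_gradient \<epsilon> (y - z) $ i)"
    by simp
  also have "\<dots> = (LINT z|lebesgue. (\<Sum>i\<in>UNIV. \<Psi> i z * mollifier_gradient \<epsilon> (y - z) $ i))"
    by (intro Bochner_Integration.integral_sum[symmetric]
          integrable_continuous_compact_support[OF _ S] continuous_intros \<Psi>(1))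
       (use \<Psi>(2) in simp)
  also have "\<dots> = - (LINT z|lebesgue. (\<Sum>i\<in>UNIV. \<Psi> i z * ?X z $ i))"
    by (simp add: sum_negf)
  also have "(LINT z|lebesgue. (\<Sum>i\<in>UNIV. \<Psi> i z * ?X z $ i))
      = - (LINT z|lebesgue. w z * mollifier \<epsilon> (y - z))"
  proof -
    have "((\<lambda>z. mollifier \<epsilon> (y - z)) has_derivative (\<lambda>h. ?X x \<bullet> h)) (at x)" for x
    proof -
      have "((\<lambda>z. mollifier \<epsilon> (y - z)) has_derivative (\<lambda>h. mollifier_gradient \<epsilon> (y - x) \<bullet> (0 - h))) (at x)"
        by (rule has_derivative_compose[OF _ has_derivative_mollifier]) (intro derivative_intros)
      then show ?thesis
        by simp
    qed
    moreover have "continuous_on UNIV ?X"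
      by (intro continuous_intros)
    ultimately show ?thesis
      by (intro has_weak_divergenceD[OF div] allI)
  qed
  finally show ?thesis
    by (simp add: mollify_def[of \<epsilon> w] mult.commute)
qed

text \<open>The defining identity of the weak gradient holds for the mollifications of \<open>\<Psi>\<close>, whose components
  are test functions with divergence \<open>mollify (e k) w\<close>; both sides converge.\<close>
lemma weak_gradient_against_field:
  fixes \<Psi> :: "'n::finite \<Rightarrow> real^'n \<Rightarrow> real"
  assumes U: "open U" and g: "has_weak_gradient U f g"
    and S: "compact S" "S \<subseteq> U"
    and \<Psi>: "\<And>i. continuous_on UNIV (\<Psi> i)" "\<forall>i z. z \<notin> S \<longrightarrow> \<Psi> i z = 0"
    and w: "continuous_on UNIV w" "\<forall>z. z \<notin> S \<longrightarrow> w z = 0"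
    and div: "has_weak_divergence \<Psi> w"
  shows "(LINT x:U|lebesgue. f x * w x) = - (LINT x:U|lebesgue. \<Sum>i\<in>UNIV. g x $ i * \<Psi> i x)"
proof -
  obtain e where e: "\<And>k. 0 < e k"
    and test_e: "\<And>\<psi> k. continuous_on UNIV \<psi> \<Longrightarrow> \<forall>z. z \<notin> S \<longrightarrow> \<psi> z = 0 \<Longrightarrow> mollify (e k) \<psi> \<in> test_functions U"
    and lim: "\<And>h \<psi>. locally_integrable U h \<Longrightarrow> continuous_on UNIV \<psi> \<Longrightarrow> \<forall>z. z \<notin> S \<longrightarrow> \<psi> z = 0 \<Longrightarrow>
      (\<lambda>k. LINT x:U|lebesgue. h x * mollify (e k) \<psi> x) \<longlonglongrightarrow> (LINT x:U|lebesgue. h x * \<psi> x)"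
    by (rule mollifying_sequence[OF S U]) (rule that)
  have \<Psi>': "\<forall>z. z \<notin> S \<longrightarrow> \<Psi> i z = 0" for i
    using \<Psi>(2) by blast
  have f: "locally_integrable U f" and gi: "locally_integrable U (\<lambda>x. g x $ i)" for i
    using g by (auto simp: has_weak_gradient_def intro!: locally_integrable_component)
  have test: "mollify (e k) (\<Psi> i) \<in> test_functions U" for k i
    by (rule test_e[OF \<Psi>(1) \<Psi>'])
  have eq: "(LINT x:U|lebesgue. f x * mollify (e k) w x)
      = - (\<Sum>i\<in>UNIV. LINT x:U|lebesgue. g x $ i * mollify (e k) (\<Psi> i) x)" for k
  proof -
    have "(LINT x:U|lebesgue. f x * mollify (e k) w x)
        = (LINT x:U|lebesgue. \<Sum>i\<in>UNIV. f x * gradient (mollify (e k) (\<Psi> i)) x $ i)"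
      unfolding sum_gradient_mollify[OF e S(1) \<Psi> div, symmetric] sum_distrib_left ..
    also have "\<dots> = (\<Sum>i\<in>UNIV. LINT x:U|lebesgue. f x * gradient (mollify (e k) (\<Psi> i)) x $ i)"
    proof (rule integral_sum_mult_compact_support)
      fix i
      from test[of k i] obtain T where T: "compact T" "T \<subseteq> U" "\<forall>z. z \<notin> T \<longrightarrow> gradient (mollify (e k) (\<Psi> i)) z = 0"
        "continuous_on UNIV (gradient (mollify (e k) (\<Psi> i)))"
        by (rule test_functionE)
      show "continuous_on UNIV (\<lambda>x. gradient (mollify (e k) (\<Psi> i)) x $ i)"
        by (intro continuous_intros T(4))
      show "\<exists>S. compact S \<and> S \<subseteq> U \<and> (\<forall>z. z \<notin> S \<longrightarrow> gradient (mollify (e k) (\<Psi> i)) z $ i = 0)"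
        using T by (intro exI[of _ T]) simp
    qed (rule f)
    also have "\<dots> = (\<Sum>i\<in>UNIV. - (LINT x:U|lebesgue. g x $ i * mollify (e k) (\<Psi> i) x))"
      using g test by (simp add: has_weak_gradient_def)
    finally show ?thesis
      by (simp add: sum_negf)
  qed
  have lim1: "(\<lambda>k. LINT x:U|lebesgue. f x * mollify (e k) w x) \<longlonglongrightarrow> (LINT x:U|lebesgue. f x * w x)"
    by (rule lim[OF f w])
  have lim2: "(\<lambda>k. - (\<Sum>i\<in>UNIV. LINT x:U|lebesgue. g x $ i * mollify (e k) (\<Psi> i) x))
      \<longlonglongrightarrow> - (\<Sum>i\<in>UNIV. LINT x:U|lebesgue. g x $ i * \<Psi> i x)"
    by (intro tendsto_minus tendsto_sum lim[OF gi \<Psi>(1) \<Psi>'])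
  have "(LINT x:U|lebesgue. f x * w x) = - (\<Sum>i\<in>UNIV. LINT x:U|lebesgue. g x $ i * \<Psi> i x)"
    by (rule LIMSEQ_unique[OF lim1[unfolded eq] lim2])
  also have "(\<Sum>i\<in>UNIV. LINT x:U|lebesgue. g x $ i * \<Psi> i x) = (LINT x:U|lebesgue. \<Sum>i\<in>UNIV. g x $ i * \<Psi> i x)"
    using S \<Psi>' by (intro integral_sum_mult_compact_support[symmetric] gi \<Psi>(1)) blast
  finally show ?thesis .
qed

section \<open>The chain rule for weak gradients\<close>

lemma continuous_zero_extension:
  fixes u :: "'a::euclidean_space \<Rightarrow> 'b::real_normed_vector"
  assumes "open U" "compact S" "S \<subseteq> U" "continuous_on U u" "\<forall>x\<in>U - S. u x = 0"
  shows "continuous_on UNIV (\<lambda>x. if x \<in> U then u x else 0)"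
proof -
  let ?e = "\<lambda>x. if x \<in> U then u x else 0"
  have "continuous_on U ?e"
    using assms(4) by (rule continuous_on_eq) simp
  moreover have "continuous_on (- S) ?e"
    by (rule continuous_on_eq[of _ "\<lambda>_. 0"]) (use assms(5) in auto)
  ultimately have "continuous_on (U \<union> - S) ?e"
    using assms(1,2) by (intro continuous_on_open_Un) (auto simp: open_Compl compact_imp_closed)
  moreover have "U \<union> - S = UNIV"
    using assms(3) by blast
  ultimately show ?thesis
    by simp
qed

text \<open>The integral of \<open>Q (x + t v)\<close> over all \<open>x\<close> does not depend on \<open>t\<close>; for \<open>v\<close> the \<open>j\<close>-th unit vector,
  its derivative at \<open>t = 0\<close> is the integral of the \<open>j\<close>-th partial derivative of \<open>Q\<close>.\<close>
lemma integral_derivative_compact_support: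
  fixes Q :: "real^'n::finite \<Rightarrow> real"
  assumes Q: "\<And>x. (Q has_derivative (\<lambda>h. E x \<bullet> h)) (at x)" and E: "continuous_on UNIV E"
    and S: "compact S" "\<forall>x. x \<notin> S \<longrightarrow> Q x = 0" "\<forall>x. x \<notin> S \<longrightarrow> E x = 0"
  shows "(LINT x|lebesgue. E x $ j) = 0"
proof -
  define v :: "real^'n" where "v = axis j 1"
  have "norm v = 1"
    by (simp add: v_def norm_axis_1)
  \<comment> \<open>Translations by at most a unit length keep the support inside one box.\<close>
  define N where "N = (\<Union>x\<in>S. \<Union>z\<in>cball 0 1. {x + z})"
  have "compact N"
    unfolding N_def by (rule compact_sums'[OF S(1) compact_cball])
  then obtain b where b: "N \<subseteq> cbox (- b) b"
    using bounded_subset_cbox_symmetric[OF compact_imp_bounded] by metis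
  have N: "x + t *\<^sub>R v \<notin> S" if "\<bar>t\<bar> \<le> 1" "x \<notin> cbox (- b) b" for t x
  proof
    assume "x + t *\<^sub>R v \<in> S"
    then have "x \<in> N"
      unfolding N_def by (rule mem_closed_neighbourhoodI) (simp add: \<open>norm v = 1\<close> that(1))
    then show False
      using b that(2) by blast
  qed
  have contQ: "continuous_on UNIV Q"
    by (intro continuous_at_imp_continuous_on ballI has_derivative_continuous[OF Q])
  have const: "integral (cbox (- b) b) (\<lambda>x. Q (x + t *\<^sub>R v)) = (LINT x|lebesgue. Q x)" if "\<bar>t\<bar> \<le> 1" for t
  proof -
    have "(LINT x|lebesgue. Q (x + t *\<^sub>R v)) = (LINT x|lebesgue. Q x)"
      using lebesgue_integral_translate[of Q "- (t *\<^sub>R v)"] borel_measurable_continuous_onI[OF contQ] by simp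
    moreover have "(LINT x|lebesgue. Q (x + t *\<^sub>R v)) = integral (cbox (- b) b) (\<lambda>x. Q (x + t *\<^sub>R v))"
      using N[OF that] S(2)
      by (intro lebesgue_integral_eq_integral_cbox continuous_on_compose2[OF contQ] continuous_intros) auto
    ultimately show ?thesis
      by simp
  qed
  have "((\<lambda>t. integral (cbox (- b) b) (\<lambda>x. Q (x + t *\<^sub>R v))) has_vector_derivative
      integral (cbox (- b) b) (\<lambda>x. E (x + 0 *\<^sub>R v) \<bullet> v)) (at 0 within {-1<..<1})"
  proof (rule leibniz_rule_vector_derivative)
    fix t :: real and x :: "real^'n"
    have "((\<lambda>t. Q (x + t *\<^sub>R v)) has_derivative (\<lambda>s. E (x + t *\<^sub>R v) \<bullet> (0 + s *\<^sub>R v))) (at t)"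
      by (rule has_derivative_compose[OF _ Q]) (intro derivative_intros)
    then show "((\<lambda>t. Q (x + t *\<^sub>R v)) has_vector_derivative E (x + t *\<^sub>R v) \<bullet> v) (at t within {-1<..<1})"
      by (simp add: has_vector_derivative_def has_derivative_at_withinI)
  next
    show "(\<lambda>x. Q (x + t *\<^sub>R v)) integrable_on cbox (- b) b" for t
      by (intro integrable_continuous continuous_on_compose2[OF contQ] continuous_intros) auto
    show "continuous_on ({-1<..<1} \<times> cbox (- b) b) (\<lambda>(t, x). E (x + t *\<^sub>R v) \<bullet> v)"
      unfolding split_beta by (intro continuous_on_compose2[OF E] continuous_intros) auto
  qed auto
  then have der: "((\<lambda>t. integral (cbox (- b) b) (\<lambda>x. Q (x + t *\<^sub>R v))) has_vector_derivative
      integral (cbox (- b) b) (\<lambda>x. E x $ j)) (at 0)"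
    by (simp add: at_within_open[of 0 "{-1<..<1::real}"] v_def inner_axis)
  have "((\<lambda>t. integral (cbox (- b) b) (\<lambda>x. Q (x + t *\<^sub>R v))) has_vector_derivative 0) (at 0)"
    by (rule has_vector_derivative_transform_within_open[of "\<lambda>_. LINT x|lebesgue. Q x" _ _ "{-1<..<1::real}"])
       (auto simp: const)
  with der have "integral (cbox (- b) b) (\<lambda>x. E x $ j) = 0"
    by (rule vector_derivative_unique_at)
  moreover have "(LINT x|lebesgue. E x $ j) = integral (cbox (- b) b) (\<lambda>x. E x $ j)"
    using N[of 0] S(3) by (intro lebesgue_integral_eq_integral_cbox continuous_intros E) auto
  ultimately show ?thesis
    by simp
qed

lemma locally_integrable_mult_continuous:
  fixes h q :: "real^'n::finite \<Rightarrow> real"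
  assumes "locally_integrable U h" "continuous_on U q"
  shows "locally_integrable U (\<lambda>x. q x * h x)"
  unfolding locally_integrable_def
proof (intro allI impI)
  fix S
  assume S: "compact S \<and> S \<subseteq> U"
  then show "set_integrable lebesgue S (\<lambda>x. q x * h x)"
    using assms by (intro set_integrable_mult_continuous) (simp_all add: locally_integrable_def continuous_on_subset)
qed

lemma locally_integrable_vecI:
  fixes g :: "real^'n::finite \<Rightarrow> real^'m::finite"
  assumes "\<And>j. locally_integrable U (\<lambda>x. g x $ j)"
  shows "locally_integrable U g"
  unfolding locally_integrable_def
proof (intro allI impI)
  fix S :: "(real^'n) set"
  assume S: "compact S \<and> S \<subseteq> U"
  show "set_integrable lebesgue S g"
  proof (rule absolutely_integrable_componentwise)
    fix b :: "real^'m"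
    assume "b \<in> Basis"
    then obtain j where "b = axis j 1"
      by (auto simp: Basis_vec_def)
    then show "set_integrable lebesgue S (\<lambda>x. g x \<bullet> b)"
      using assms[of j] S by (simp add: inner_axis locally_integrable_def)
  qed
qed

text \<open>The change of variables gives the integrability of \<open>\<bar>det J\<bar> (u \<circ> F)\<close>, and \<open>1 / \<bar>det J\<bar>\<close> is bounded
  on compact sets.\<close>
lemma locally_integrable_compose_diffeo:
  fixes F :: "real^'n::finite \<Rightarrow> real^'n" and u :: "real^'n \<Rightarrow> real"
  assumes F: "\<And>x. x \<in> U \<Longrightarrow> (F has_derivative (\<lambda>h. J x *v h)) (at x)" and inj: "inj_on F U"
    and J: "continuous_on U (\<lambda>x. det (J x))" "\<forall>x\<in>U. det (J x) \<noteq> 0"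
    and sub: "F ` U \<subseteq> \<Omega>" and u: "locally_integrable \<Omega> u"
  shows "locally_integrable U (\<lambda>x. u (F x))"
  unfolding locally_integrable_def
proof (intro allI impI)
  fix S
  assume "compact S \<and> S \<subseteq> U"
  then have S: "compact S" "S \<subseteq> U" "S \<in> sets lebesgue"
    by (auto simp: lmeasurable_compact fmeasurableD)
  have der: "(F has_derivative (\<lambda>h. J x *v h)) (at x within S)" if "x \<in> S" for x
    by (rule has_derivative_at_withinI[OF F[OF subsetD[OF S(2) that]]])
  have "continuous_on S F"
    by (rule has_derivative_continuous_on[OF der])
  then have "compact (F ` S)"
    using S(1) by (rule compact_continuous_image)
  then have "set_integrable lebesgue (F ` S) u"
    using u sub S(2) by (auto simp: locally_integrable_def)
  then have "set_integrable lebesgue S (\<lambda>x. \<bar>det (J x)\<bar> * u (F x))"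
    using lebesgue_change_of_variables(1)[OF S(3) der inj_on_subset[OF inj S(2)], of u] by simp
  moreover have "continuous_on S (\<lambda>x. inverse \<bar>det (J x)\<bar>)"
    using S(2) J by (intro continuous_intros continuous_on_subset[OF J(1)]) auto
  ultimately have "set_integrable lebesgue S (\<lambda>x. inverse \<bar>det (J x)\<bar> * (\<bar>det (J x)\<bar> * u (F x)))"
    using S(1) by (metis (mono_tags) set_integrable_mult_continuous)
  then show "set_integrable lebesgue S (\<lambda>x. u (F x))"
    by (subst set_integrable_cong[OF refl refl, of S _ "\<lambda>x. inverse \<bar>det (J x)\<bar> * (\<bar>det (J x)\<bar> * u (F x))"])
      (use S(2) J(2) in auto)
qed

lemma continuous_on_det:
  fixes A :: "'a::topological_space \<Rightarrow> real^'n^'n"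
  assumes "continuous_on S A"
  shows "continuous_on S (\<lambda>x. det (A x))"
  unfolding det_def by (intro continuous_intros assms)

definition push_forward :: "('a \<Rightarrow> 'b) \<Rightarrow> 'a set \<Rightarrow> ('a \<Rightarrow> real) \<Rightarrow> 'b \<Rightarrow> real" where
  "push_forward F U u y = (if y \<in> F ` U then u (inv_into U F y) else 0)"

lemma push_forward_image [simp]: "inj_on F U \<Longrightarrow> x \<in> U \<Longrightarrow> push_forward F U u (F x) = u x"
  by (simp add: push_forward_def)

lemma push_forward_eq_0:
  assumes "inj_on F U" "\<forall>x. x \<notin> S \<longrightarrow> u x = 0" "y \<notin> F ` S"
  shows "push_forward F U u y = 0"
  using assms by (auto simp: push_forward_def)

lemma continuous_push_forward:
  fixes F :: "real^'n::finite \<Rightarrow> real^'n"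
  assumes U: "open U" and F: "continuous_on U F" "inj_on F U" and S: "compact S" "S \<subseteq> U"
    and u: "continuous_on U u" "\<forall>x. x \<notin> S \<longrightarrow> u x = 0"
  shows "continuous_on UNIV (push_forward F U u)"
  unfolding push_forward_def[abs_def]
proof (rule continuous_zero_extension)
  show "open (F ` U)"
    by (rule invariance_of_domain[OF F(1) U F(2)])
  show "compact (F ` S)"
    by (rule compact_continuous_image[OF continuous_on_subset[OF F(1) S(2)] S(1)])
  show "F ` S \<subseteq> F ` U"
    using S(2) by blast
  have "continuous_on (F ` U) (inv_into U F)"
    by (rule continuous_on_inverse_open[OF U F(1)]) (auto simp: F(2))
  then show "continuous_on (F ` U) (\<lambda>y. u (inv_into U F y))"
    by (rule continuous_on_compose2[OF u(1)]) (auto simp: inv_into_into)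
  show "\<forall>y\<in>F ` U - F ` S. u (inv_into U F y) = 0"
    using u(2) F(2) by (auto simp: inv_into_f_f)
qed

text \<open>The change of variables in the form used for integrands that contain functions pushed forward
  from \<open>U\<close>: these vanish outside \<open>F ` U\<close>, and \<open>k\<close> is the transformed integrand.\<close>
lemma integral_push_forward:
  fixes F :: "real^'n::finite \<Rightarrow> real^'n" and h :: "real^'n \<Rightarrow> real"
  assumes U: "open U" and F: "\<And>x. x \<in> U \<Longrightarrow> (F has_derivative (\<lambda>h. J x *v h)) (at x)" and inj: "inj_on F U"
    and sub: "F ` U \<subseteq> \<Omega>"
    and eq: "\<And>x. x \<in> U \<Longrightarrow> \<bar>det (J x)\<bar> * h (F x) = k x"
    and 0: "\<And>y. y \<notin> F ` U \<Longrightarrow> h y = 0"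
  shows "(LINT y:\<Omega>|lebesgue. h y) = (LINT x:U|lebesgue. k x)"
proof -
  have "(LINT y:\<Omega>|lebesgue. h y) = (LINT y:F ` U|lebesgue. h y)"
    unfolding set_lebesgue_integral_def using sub 0
    by (intro Bochner_Integration.integral_cong refl) (auto simp: indicator_def)
  also have "\<dots> = (LINT x:U|lebesgue. \<bar>det (J x)\<bar> * h (F x))"
    using lebesgue_change_of_variables(2)[of U F "\<lambda>x h. J x *v h" h] U F inj
    by (simp add: has_derivative_at_withinI)
  also have "\<dots> = (LINT x:U|lebesgue. k x)"
    using eq U by (intro set_lebesgue_integral_cong) auto
  finally show ?thesis .
qed

lemma locally_integrable_sum:
  fixes h :: "'i \<Rightarrow> real^'n::finite \<Rightarrow> real"
  assumes "\<And>i. i \<in> I \<Longrightarrow> locally_integrable U (h i)"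
  shows "locally_integrable U (\<lambda>x. \<Sum>i\<in>I. h i x)"
  unfolding locally_integrable_def
proof (intro allI impI)
  fix S
  assume S: "compact S \<and> S \<subseteq> U"
  have "integrable lebesgue (\<lambda>x. \<Sum>i\<in>I. indicator S x *\<^sub>R h i x)"
    using assms S by (intro Bochner_Integration.integrable_sum) (simp add: locally_integrable_def set_integrable_def)
  then show "set_integrable lebesgue S (\<lambda>x. \<Sum>i\<in>I. h i x)"
    by (simp only: set_integrable_def scaleR_right.sum)
qed

text \<open>The change of variables moves the defining identity, tested with \<open>\<phi>\<close>, to \<open>\<Omega>\<close>, where it is the
  identity for \<open>g\<close> tested with the Piola transform \<open>\<Psi>\<close> of \<open>\<phi> e\<^sub>j\<close>.  That \<open>\<Psi>\<close> has the weak divergence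
  \<open>w\<close> is checked by moving a second time, back to \<open>U\<close>: there it says that
  \<open>\<partial>\<^sub>j (\<phi> (\<zeta> \<circ> F))\<close> integrates to zero.\<close>
theorem has_weak_gradient_compose_diffeo:
  fixes F :: "real^'n::finite \<Rightarrow> real^'n"
  assumes U: "open U" and \<Omega>: "open \<Omega>"
    and F: "\<And>x. x \<in> U \<Longrightarrow> (F has_derivative (\<lambda>h. J x *v h)) (at x)" and inj: "inj_on F U"
    and J: "continuous_on U J" "\<forall>x\<in>U. det (J x) \<noteq> 0"
    and sub: "F ` U \<subseteq> \<Omega>" and g: "has_weak_gradient \<Omega> f g"
  shows "has_weak_gradient U (f \<circ> F) (\<lambda>x. transpose (J x) *v g (F x))"
  unfolding has_weak_gradient_def
proof (intro conjI ballI allI)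
  note detJ = continuous_on_det[OF J(1)]
  have f: "locally_integrable \<Omega> f" and gi: "locally_integrable \<Omega> (\<lambda>x. g x $ i)" for i
    using g by (auto simp: has_weak_gradient_def intro!: locally_integrable_component)
  note compose = locally_integrable_compose_diffeo[OF F inj detJ J(2) sub]
  show "locally_integrable U (f \<circ> F)"
    using compose[OF _ f] by (simp add: o_def)
  show "locally_integrable U (\<lambda>x. transpose (J x) *v g (F x))"
  proof (rule locally_integrable_vecI)
    fix j
    have "locally_integrable U (\<lambda>x. J x $ i $ j * g (F x) $ i)" for i
      by (rule locally_integrable_mult_continuous[OF compose[OF _ gi]]) (auto intro!: continuous_intros J(1))
    then have "locally_integrable U (\<lambda>x. \<Sum>i\<in>UNIV. J x $ i $ j * g (F x) $ i)"
      by (intro locally_integrable_sum)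
    then show "locally_integrable U (\<lambda>x. (transpose (J x) *v g (F x)) $ j)"
      by (simp add: matrix_vector_mult_def transpose_def)
  qed
  fix \<phi> :: "real^'n \<Rightarrow> real" and j
  assume "\<phi> \<in> test_functions U"
  then obtain S where S: "compact S" "S \<subseteq> U" and \<phi>: "\<forall>z. z \<notin> S \<longrightarrow> \<phi> z = 0" "\<forall>z. z \<notin> S \<longrightarrow> gradient \<phi> z = 0"
    "continuous_on UNIV \<phi>" "continuous_on UNIV (gradient \<phi>)"
    and der_\<phi>: "\<And>x. (\<phi> has_derivative (\<lambda>h. gradient \<phi> x \<bullet> h)) (at x)"
    by (rule test_functionE) (rule that)
  have contF: "continuous_on U F"
    by (intro continuous_at_imp_continuous_on ballI has_derivative_continuous[OF F])
  \<comment> \<open>The Piola transform of \<open>\<phi> e\<^sub>j\<close> is \<open>\<Psi>\<close>, and \<open>w\<close> is its divergence.\<close>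
  define w where "w = push_forward F U (\<lambda>x. gradient \<phi> x $ j / \<bar>det (J x)\<bar>)"
  define \<Psi> where "\<Psi> i = push_forward F U (\<lambda>x. \<phi> x * J x $ i $ j / \<bar>det (J x)\<bar>)" for i
  have FS: "compact (F ` S)" "F ` S \<subseteq> \<Omega>"
    using sub S compact_continuous_image[OF continuous_on_subset[OF contF S(2)] S(1)] by auto
  have cont_w: "continuous_on UNIV w" unfolding w_def
    by (rule continuous_push_forward[OF U contF inj S])
       (use \<phi> J(2) in \<open>auto intro!: continuous_intros detJ intro: continuous_on_subset\<close>)
  have cont_\<Psi>: "continuous_on UNIV (\<Psi> i)" for i unfolding \<Psi>_def
    by (rule continuous_push_forward[OF U contF inj S])
       (use \<phi> J(2) in \<open>auto intro!: continuous_intros detJ J(1) intro: continuous_on_subset\<close>)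
  have w0: "\<forall>z. z \<notin> F ` S \<longrightarrow> w z = 0" and \<Psi>0: "\<forall>i z. z \<notin> F ` S \<longrightarrow> \<Psi> i z = 0"
    unfolding w_def \<Psi>_def by (auto intro!: push_forward_eq_0[OF inj, of S] simp: \<phi>)
  have notin: "y \<notin> F ` S" if "y \<notin> F ` U" for y
    using that S(2) by blast
  have div: "has_weak_divergence \<Psi> w"
    unfolding has_weak_divergence_def
  proof (intro allI impI, elim conjE)
    fix \<zeta> :: "real^'n \<Rightarrow> real" and X
    assume \<zeta>: "\<forall>x. (\<zeta> has_derivative (\<lambda>h. X x \<bullet> h)) (at x)" and X: "continuous_on UNIV X"
    have cont_\<zeta>: "continuous_on UNIV \<zeta>"
      using \<zeta> by (intro continuous_at_imp_continuous_on ballI) (blast intro: has_derivative_continuous)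
    \<comment> \<open>The two product rule terms of \<open>\<partial>\<^sub>j Q = a + b\<close> for \<open>Q = \<phi> (\<zeta> \<circ> F)\<close>, and the full gradient \<open>E\<close> of \<open>Q\<close>.\<close>
    define a where "a x = \<phi> x * (\<Sum>i\<in>UNIV. J x $ i $ j * X (F x) $ i)" for x
    define b where "b x = gradient \<phi> x $ j * \<zeta> (F x)" for x
    define Q where "Q x = (if x \<in> U then \<phi> x * \<zeta> (F x) else 0)" for x
    define E where "E x = (if x \<in> U then \<phi> x *\<^sub>R (transpose (J x) *v X (F x)) + \<zeta> (F x) *\<^sub>R gradient \<phi> x else 0)" for x
    have contE: "continuous_on UNIV E" unfolding E_def
    proof (rule continuous_zero_extension[OF U S])
      have "continuous_on U (\<lambda>x. transpose (J x) *v X (F x))"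
        unfolding matrix_vector_mult_def transpose_def
        by (simp, intro continuous_intros J(1) continuous_on_compose2[OF X contF]) auto
      then show "continuous_on U (\<lambda>x. \<phi> x *\<^sub>R (transpose (J x) *v X (F x)) + \<zeta> (F x) *\<^sub>R gradient \<phi> x)"
        by (intro continuous_intros continuous_on_compose2[OF cont_\<zeta> contF]
              continuous_on_subset[OF \<phi>(3)] continuous_on_subset[OF \<phi>(4)]) auto
    qed (use \<phi> in auto)
    have derQ: "(Q has_derivative (\<lambda>h. E x \<bullet> h)) (at x)" for x
    proof (cases "x \<in> U")
      case True
      have "((\<lambda>x. \<zeta> (F x)) has_derivative (\<lambda>h. X (F x) \<bullet> (J x *v h))) (at x)"
        by (rule has_derivative_compose[OF F[OF True]]) (use \<zeta> in blast)
      from has_derivative_mult[OF der_\<phi> this]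
      have "((\<lambda>x. \<phi> x * \<zeta> (F x)) has_derivative
          (\<lambda>h. \<phi> x * (X (F x) \<bullet> (J x *v h)) + (gradient \<phi> x \<bullet> h) * \<zeta> (F x))) (at x)" .
      then have "((\<lambda>x. \<phi> x * \<zeta> (F x)) has_derivative (\<lambda>h. E x \<bullet> h)) (at x)"
        using True
        by (simp add: E_def inner_add_left mult.commute dot_lmul_matrix[symmetric])
      then show ?thesis
        by (rule has_derivative_transform_within_open[OF _ U True]) (simp add: Q_def)
    next
      case False
      then have x: "x \<in> - S"
        using S(2) by blast
      have "E x = 0"
        using False by (simp add: E_def)
      moreover have "((\<lambda>_. 0) has_derivative (\<lambda>h. 0)) (at x)"
        by (rule has_derivative_const)
      then have "(Q has_derivative (\<lambda>h. 0)) (at x)"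
        by (rule has_derivative_transform_within_open[OF _ _ x])
           (use S(1) \<phi>(1) in \<open>auto simp: Q_def open_Compl compact_imp_closed\<close>)
      ultimately show ?thesis
        by simp
    qed
    have "(LINT x|lebesgue. E x $ j) = 0"
      using \<phi>(1,2) by (intro integral_derivative_compact_support[OF derQ contE S(1)]) (auto simp: Q_def E_def)
    moreover have "(LINT x|lebesgue. E x $ j) = (LINT x:U|lebesgue. a x + b x)"
      unfolding set_lebesgue_integral_def
      by (intro Bochner_Integration.integral_cong refl)
         (simp add: E_def a_def b_def indicator_def matrix_vector_mult_def transpose_def mult.commute)
    moreover have "set_integrable lebesgue U a" "set_integrable lebesgue U b"
    proof -
      have int: "set_integrable lebesgue U u" if "continuous_on U u" "\<forall>x. x \<notin> S \<longrightarrow> u x = 0" for u :: "real^'n \<Rightarrow> real"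
      proof -
        have "continuous_on UNIV (\<lambda>x. if x \<in> U then u x else 0)"
          by (rule continuous_zero_extension[OF U S that(1)]) (use that(2) in auto)
        then have "integrable lebesgue (\<lambda>x. if x \<in> U then u x else 0)"
          by (rule integrable_continuous_compact_support[OF _ S(1)]) (use that(2) in auto)
        moreover have "(\<lambda>x. if x \<in> U then u x else 0) = (\<lambda>x. indicator U x *\<^sub>R u x)"
          by (auto simp: indicator_def)
        ultimately show ?thesis
          by (simp add: set_integrable_def)
      qed
      show "set_integrable lebesgue U a" unfolding a_def
        by (rule int, intro continuous_intros J(1) continuous_on_compose2[OF X contF] continuous_on_subset[OF \<phi>(3)])
           (use \<phi> in auto)
      show "set_integrable lebesgue U b" unfolding b_def
        by (rule int, intro continuous_intros continuous_on_compose2[OF cont_\<zeta> contF] continuous_on_subset[OF \<phi>(4)])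
           (use \<phi> in auto)
    qed
    ultimately have ab: "(LINT x:U|lebesgue. a x) = - (LINT x:U|lebesgue. b x)"
      by (simp add: set_integral_add)
    have "(LINT y:UNIV|lebesgue. (\<Sum>i\<in>UNIV. \<Psi> i y * X y $ i)) = (LINT x:U|lebesgue. a x)"
    proof (rule integral_push_forward[OF U F inj])
      show "\<bar>det (J x)\<bar> * (\<Sum>i\<in>UNIV. \<Psi> i (F x) * X (F x) $ i) = a x" if "x \<in> U" for x
        using that J(2) by (simp add: \<Psi>_def inj a_def sum_distrib_left mult_ac)
    qed (use \<Psi>0 notin in auto)
    moreover have "(LINT y:UNIV|lebesgue. w y * \<zeta> y) = (LINT x:U|lebesgue. b x)"
    proof (rule integral_push_forward[OF U F inj])
      show "\<bar>det (J x)\<bar> * (w (F x) * \<zeta> (F x)) = b x" if "x \<in> U" for x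
        using that J(2) by (simp add: w_def inj b_def mult_ac)
    qed (use w0 notin in auto)
    ultimately show "(LINT y|lebesgue. (\<Sum>i\<in>UNIV. \<Psi> i y * X y $ i)) = - (LINT y|lebesgue. w y * \<zeta> y)"
      using ab by (simp add: set_lebesgue_integral_def)
  qed
  have "(LINT x:U|lebesgue. (f \<circ> F) x * gradient \<phi> x $ j) = (LINT y:\<Omega>|lebesgue. f y * w y)"
  proof (rule integral_push_forward[OF U F inj sub, symmetric])
    show "\<bar>det (J x)\<bar> * (f (F x) * w (F x)) = (f \<circ> F) x * gradient \<phi> x $ j" if "x \<in> U" for x
      using that J(2) by (simp add: w_def inj)
  qed (use w0 notin in auto)
  also have "\<dots> = - (LINT y:\<Omega>|lebesgue. \<Sum>i\<in>UNIV. g y $ i * \<Psi> i y)"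
    by (rule weak_gradient_against_field[OF \<Omega> g FS cont_\<Psi> \<Psi>0 cont_w w0 div])
  also have "(LINT y:\<Omega>|lebesgue. \<Sum>i\<in>UNIV. g y $ i * \<Psi> i y)
      = (LINT x:U|lebesgue. (transpose (J x) *v g (F x)) $ j * \<phi> x)"
  proof (rule integral_push_forward[OF U F inj sub])
    show "\<bar>det (J x)\<bar> * (\<Sum>i\<in>UNIV. g (F x) $ i * \<Psi> i (F x)) = (transpose (J x) *v g (F x)) $ j * \<phi> x" if "x \<in> U" for x
      using that J(2)
      by (simp add: \<Psi>_def inj matrix_vector_mult_def transpose_def sum_distrib_left sum_distrib_right mult_ac)
  qed (use \<Psi>0 notin in auto)
  finally show "(LINT x:U|lebesgue. (f \<circ> F) x * gradient \<phi> x $ j)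
      = - (LINT x:U|lebesgue. (transpose (J x) *v g (F x)) $ j * \<phi> x)" .
qed

section \<open>Ellipticity of the cell tensors and of their diagonal approximations\<close>

lemma has_derivative_jacobian_matrix:
  assumes "F differentiable_on ref_cube" "x \<in> ref_cube"
  shows "(F has_derivative (\<lambda>h. jacobian_matrix F x *v h)) (at x within ref_cube)"
proof -
  have D: "(F has_derivative frechet_derivative F (at x within ref_cube)) (at x within ref_cube)"
    using assms by (simp add: differentiable_on_def frechet_derivative_works)
  then have "(\<lambda>h. jacobian_matrix F x *v h) = frechet_derivative F (at x within ref_cube)"
    unfolding jacobian_matrix_def by (simp add: matrix_vector_mul(2) has_derivative_linear)
  then show ?thesis
    using D by simp
qed

lemma matrix_inv_transpose_mult:
  fixes A :: "real^'n::finite^'n"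
  assumes "invertible A"
  shows "transpose (matrix_inv A) *v (transpose A *v x) = x"
    and "transpose A *v (transpose (matrix_inv A) *v x) = x"
proof -
  have "A ** matrix_inv A = mat 1" "matrix_inv A ** A = mat 1"
    using someI_ex[OF assms[unfolded invertible_def]] by (auto simp: matrix_inv_def)
  then have "transpose (matrix_inv A) ** transpose A = mat 1" "transpose A ** transpose (matrix_inv A) = mat 1"
    by (simp_all flip: matrix_transpose_mul add: transpose_mat)
  then show "transpose (matrix_inv A) *v (transpose A *v x) = x"
    and "transpose A *v (transpose (matrix_inv A) *v x) = x"
    by (simp_all add: matrix_vector_mul_assoc del: transpose_matrix_vector)
qed

lemma G_hat_quadratic:
  fixes F :: "real^'n::finite \<Rightarrow> real^'n"
  assumes "x \<in> ref_cube"
  shows "\<xi> \<bullet> (G_hat F x *v \<xi>) =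
    \<bar>det (jacobian_matrix F x)\<bar> * (norm (transpose (matrix_inv (jacobian_matrix F x)) *v \<xi>))\<^sup>2"
proof -
  let ?B = "matrix_inv (jacobian_matrix F x)"
  have "\<xi> \<bullet> ((?B ** transpose ?B) *v \<xi>) = (transpose ?B *v \<xi>) \<bullet> (transpose ?B *v \<xi>)"
    by (simp add: matrix_vector_mul_assoc[symmetric] dot_lmul_matrix[symmetric] )
  then show ?thesis
    using assms by (simp add: G_hat_def scaleR_matrix_vector_assoc[symmetric] power2_norm_eq_inner)
qed

definition elliptic_tensors :: "(real^'n \<Rightarrow> real^'n^'n) set \<Rightarrow> real \<Rightarrow> real \<Rightarrow> bool" where
  "elliptic_tensors \<G> l L \<longleftrightarrow> 0 < l \<and> 0 < L \<and>
     (\<forall>G\<in>\<G>. \<forall>x\<in>ref_cube. \<forall>\<xi>. l * (norm \<xi>)\<^sup>2 \<le> \<xi> \<bullet> (G x *v \<xi>) \<and> \<xi> \<bullet> (G x *v \<xi>) \<le> L * (norm \<xi>)\<^sup>2)"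

lemma zero_in_ref_cube: "0 \<in> ref_cube"
  by (simp add: ref_cube_def mem_box_cart)

lemma compact_ref_cube: "compact ref_cube"
  by (simp add: ref_cube_def)

text \<open>The quadratic form of the tensor at \<open>\<xi>\<close> is \<open>\<bar>det J\<bar> \<bar>J\<^sup>-\<^sup>T \<xi>\<bar>\<^sup>2\<close>.  With \<open>v = J\<^sup>-\<^sup>T \<xi>\<close> it suffices to bound
  \<open>\<bar>J\<^sup>T v\<bar>\<close> by multiples of \<open>\<bar>v\<bar>\<close> from both sides, and \<open>\<bar>det J\<bar>\<close> between positive constants; on the
  compact product of the cube and the unit sphere these continuous functions attain their extrema.\<close>
lemma cell_tensor_elliptic:
  fixes F :: "real^'n::finite \<Rightarrow> real^'n"
  assumes F: "cell_diffeo F K"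
  shows "\<exists>l L. elliptic_tensors {G_hat F} l L"
proof -
  let ?J = "jacobian_matrix F"
  define N where "N x v = norm (transpose (?J x) *v v)" for x v
  let ?R = "ref_cube :: (real^'n) set"
  have J: "continuous_on ?R ?J" and inv: "\<And>x. x \<in> ?R \<Longrightarrow> invertible (?J x)"
    using F by (auto simp: cell_diffeo_def)
  have detJ: "continuous_on ?R (\<lambda>x. \<bar>det (?J x)\<bar>)"
    by (intro continuous_intros continuous_on_det J)
  have ne: "?R \<noteq> {}"
    using zero_in_ref_cube by blast
  obtain d where d: "d > 0" "\<And>x. x \<in> ?R \<Longrightarrow> d \<le> \<bar>det (?J x)\<bar>"
  proof -
    obtain y where y: "y \<in> ?R" "\<forall>x\<in>?R. \<bar>det (?J y)\<bar> \<le> \<bar>det (?J x)\<bar>"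
      using continuous_attains_inf[OF compact_ref_cube ne detJ] by blast
    then show thesis
      using that[of "\<bar>det (?J y)\<bar>"] inv[OF y(1)] by (simp add: invertible_det_nz)
  qed
  obtain D where D: "\<And>x. x \<in> ?R \<Longrightarrow> \<bar>det (?J x)\<bar> \<le> D"
    using continuous_attains_sup[OF compact_ref_cube ne detJ] by metis
  have D_pos: "D > 0"
    using d D[OF zero_in_ref_cube] d(2)[OF zero_in_ref_cube] by linarith
  have contN: "continuous_on (?R \<times> sphere 0 1) (\<lambda>q. N (fst q) (snd q))"
    unfolding N_def matrix_vector_mult_def transpose_def
    by (simp, intro continuous_intros continuous_on_compose2[OF J]) auto
  have compact: "compact (?R \<times> sphere (0::real^'n) 1)"
    by (intro compact_Times compact_ref_cube compact_sphere)
  have nonempty: "?R \<times> sphere (0::real^'n) 1 \<noteq> {}"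
    using ne vector_choose_size[of 1] by (auto simp: dist_norm)
  have unit: "(x, v /\<^sub>R norm v) \<in> ?R \<times> sphere 0 1" if "x \<in> ?R" "v \<noteq> 0" for x v
    using that by simp
  have scale: "N x v = norm v * N x (v /\<^sub>R norm v)" if "v \<noteq> 0" for x v
    using that by (simp add: N_def matrix_vector_mult_scaleR del: transpose_matrix_vector)
  obtain m where m: "m > 0" "\<And>x v. x \<in> ?R \<Longrightarrow> m * norm v \<le> N x v"
  proof -
    obtain p where p: "p \<in> ?R \<times> sphere 0 1" "\<forall>q\<in>?R \<times> sphere 0 1. N (fst p) (snd p) \<le> N (fst q) (snd q)"
      using continuous_attains_inf[OF compact nonempty contN] by metis
    have "transpose (?J (fst p)) *v snd p \<noteq> 0"
    proof
      assume "transpose (?J (fst p)) *v snd p = 0"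
      then have "snd p = 0"
        using matrix_inv_transpose_mult(1)[OF inv, of "fst p" "snd p"] p(1) by auto
      then show False
        using p(1) by auto
    qed
    then have pos: "N (fst p) (snd p) > 0"
      by (simp add: N_def)
    have "N (fst p) (snd p) * norm v \<le> N x v" if "x \<in> ?R" for x v
    proof (cases "v = 0")
      case False
      have "N (fst p) (snd p) \<le> N x (v /\<^sub>R norm v)"
        using bspec[OF p(2) unit[OF that False]] by simp
      then show ?thesis
        unfolding scale[OF False] by (simp add: mult.commute mult_left_mono)
    qed (simp add: N_def)
    then show thesis
      by (rule that[OF pos])
  qed
  obtain M where M: "M > 0" "\<And>x v. x \<in> ?R \<Longrightarrow> N x v \<le> M * norm v"
  proof -
    obtain p where p: "p \<in> ?R \<times> sphere 0 1" "\<forall>q\<in>?R \<times> sphere 0 1. N (fst q) (snd q) \<le> N (fst p) (snd p)"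
      using continuous_attains_sup[OF compact nonempty contN] by metis
    have "N x v \<le> (N (fst p) (snd p) + 1) * norm v" if "x \<in> ?R" for x v
    proof (cases "v = 0")
      case False
      have "N x (v /\<^sub>R norm v) \<le> N (fst p) (snd p) + 1"
        using bspec[OF p(2) unit[OF that False]] by simp
      then show ?thesis
        unfolding scale[OF False] by (simp add: mult.commute mult_left_mono)
    qed (simp add: N_def)
    moreover have "N (fst p) (snd p) + 1 > 0"
      by (simp add: N_def add_nonneg_pos)
    ultimately show thesis
      using that by metis
  qed
  have "d / M\<^sup>2 * (norm \<xi>)\<^sup>2 \<le> \<xi> \<bullet> (G_hat F x *v \<xi>) \<and> \<xi> \<bullet> (G_hat F x *v \<xi>) \<le> D / m\<^sup>2 * (norm \<xi>)\<^sup>2"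
    if x: "x \<in> ?R" for x \<xi>
  proof -
    define v where "v = transpose (matrix_inv (?J x)) *v \<xi>"
    have \<xi>: "transpose (?J x) *v v = \<xi>"
      unfolding v_def by (rule matrix_inv_transpose_mult(2)[OF inv[OF x]])
    have G: "\<xi> \<bullet> (G_hat F x *v \<xi>) = \<bar>det (?J x)\<bar> * (norm v)\<^sup>2"
      using G_hat_quadratic[OF x] by (simp add: v_def)
    have "(norm \<xi>)\<^sup>2 \<le> (M * norm v)\<^sup>2"
      using M(2)[OF x, of v] \<xi> unfolding N_def by (intro power_mono) auto
    then have "d / M\<^sup>2 * (norm \<xi>)\<^sup>2 \<le> d / M\<^sup>2 * (M * norm v)\<^sup>2"
      using d(1) by (intro mult_left_mono) auto
    also have "\<dots> = d * (norm v)\<^sup>2"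
      using M(1) by (simp add: power_mult_distrib)
    also have "\<dots> \<le> \<bar>det (?J x)\<bar> * (norm v)\<^sup>2"
      using d(2)[OF x] by (intro mult_right_mono) auto
    finally have lower: "d / M\<^sup>2 * (norm \<xi>)\<^sup>2 \<le> \<bar>det (?J x)\<bar> * (norm v)\<^sup>2" .
    have "\<bar>det (?J x)\<bar> * (norm v)\<^sup>2 \<le> D * (norm v)\<^sup>2"
      using D[OF x] by (intro mult_right_mono) auto
    also have "\<dots> = D / m\<^sup>2 * (m * norm v)\<^sup>2"
      using m(1) by (simp add: power_mult_distrib)
    also have "\<dots> \<le> D / m\<^sup>2 * (norm \<xi>)\<^sup>2"
      using m(2)[OF x, of v] m(1) \<xi> D_pos unfolding N_def by (intro mult_left_mono power_mono) auto
    finally show ?thesis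
      using lower G by simp
  qed
  then have "elliptic_tensors {G_hat F} (d / M\<^sup>2) (D / m\<^sup>2)"
    using d(1) D_pos M(1) m(1) by (simp add: elliptic_tensors_def)
  then show ?thesis
    by blast
qed

lemma elliptic_tensors_mono:
  assumes "elliptic_tensors \<G> l L" "0 < l'" "l' \<le> l" "L \<le> L'"
  shows "elliptic_tensors \<G> l' L'"
  unfolding elliptic_tensors_def
proof (intro conjI ballI allI)
  show "0 < l'" "0 < L'"
    using assms by (auto simp: elliptic_tensors_def)
  fix G :: "real^'a \<Rightarrow> real^'a^'a" and x \<xi> :: "real^'a"
  assume "G \<in> \<G>" "x \<in> ref_cube"
  then have *: "l * (norm \<xi>)\<^sup>2 \<le> \<xi> \<bullet> (G x *v \<xi>)" "\<xi> \<bullet> (G x *v \<xi>) \<le> L * (norm \<xi>)\<^sup>2"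
    using assms(1) by (auto simp: elliptic_tensors_def)
  show "l' * (norm \<xi>)\<^sup>2 \<le> \<xi> \<bullet> (G x *v \<xi>)"
    using mult_right_mono[OF assms(3), of "(norm \<xi>)\<^sup>2"] *(1) by simp
  show "\<xi> \<bullet> (G x *v \<xi>) \<le> L' * (norm \<xi>)\<^sup>2"
    using mult_right_mono[OF assms(4), of "(norm \<xi>)\<^sup>2"] *(2) by simp
qed

lemma mesh_tensors_elliptic:
  assumes "finite \<T>" "\<forall>K\<in>\<T>. cell_diffeo (F K) K"
  shows "\<exists>l L. elliptic_tensors ((\<lambda>K. G_hat (F K)) ` \<T>) l L"
  using assms
proof (induction \<T> rule: finite_induct)
  case empty
  then show ?case
    by (auto simp: elliptic_tensors_def intro: exI[of _ 1])
next
  case (insert K \<T>)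
  obtain l L where 1: "elliptic_tensors ((\<lambda>K. G_hat (F K)) ` \<T>) l L"
    using insert by auto
  obtain l' L' where 2: "elliptic_tensors {G_hat (F K)} l' L'"
    using cell_tensor_elliptic insert.prems by blast
  have pos: "0 < min l l'"
    using 1 2 by (simp add: elliptic_tensors_def)
  have "elliptic_tensors ((\<lambda>K. G_hat (F K)) ` \<T>) (min l l') (max L L')"
    "elliptic_tensors {G_hat (F K)} (min l l') (max L L')"
    by (rule elliptic_tensors_mono[OF 1 pos] elliptic_tensors_mono[OF 2 pos]; simp)+
  then have "elliptic_tensors ((\<lambda>K. G_hat (F K)) ` insert K \<T>) (min l l') (max L L')"
    by (simp add: elliptic_tensors_def)
  then show ?case
    by blast
qed

text \<open>The means of the diagonal entries are meaningful because these entries are continuous: Cramer's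
  rule expresses \<open>J\<^sup>-\<^sup>T e\<^sub>j\<close> by determinants.\<close>
lemma continuous_G_hat_diagonal:
  fixes F :: "real^'n::finite \<Rightarrow> real^'n"
  assumes F: "cell_diffeo F K"
  shows "continuous_on ref_cube (\<lambda>x. G_hat F x $ j $ j)"
proof -
  let ?J = "jacobian_matrix F"
  have J: "continuous_on ref_cube ?J" and inv: "\<And>x. x \<in> ref_cube \<Longrightarrow> invertible (?J x)"
    using F by (auto simp: cell_diffeo_def)
  \<comment> \<open>The solution of \<open>J\<^sup>T c = e\<^sub>j\<close> by Cramer's rule.\<close>
  define c where "c x = (\<chi> k. det (\<chi> i l. if l = k then axis j 1 $ i else transpose (?J x) $ i $ l) / det (?J x))" for x
  have "continuous_on ref_cube (\<lambda>x. \<bar>det (?J x)\<bar> * (norm (c x))\<^sup>2)"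
    unfolding c_def
  proof (intro continuous_intros continuous_on_det J)
    show "continuous_on ref_cube (\<lambda>x. if l = k then axis j 1 $ i else transpose (?J x) $ i $ l)" for i l k
      by (cases "l = k") (auto simp: transpose_def intro!: continuous_intros J)
    show "\<forall>x\<in>ref_cube. det (?J x) \<noteq> 0"
      using inv by (simp add: invertible_det_nz)
  qed
  moreover have "\<bar>det (?J x)\<bar> * (norm (c x))\<^sup>2 = G_hat F x $ j $ j" if x: "x \<in> ref_cube" for x
  proof -
    have "transpose (?J x) *v (transpose (matrix_inv (?J x)) *v axis j 1) = axis j 1"
      by (rule matrix_inv_transpose_mult(2)[OF inv[OF x]])
    then have "transpose (matrix_inv (?J x)) *v axis j 1 = c x"
      using cramer[of "transpose (?J x)"] inv[OF x] by (simp add: c_def invertible_det_nz det_transpose)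
    then have "axis j 1 \<bullet> (G_hat F x *v axis j 1) = \<bar>det (?J x)\<bar> * (norm (c x))\<^sup>2"
      using G_hat_quadratic[OF x] by simp
    then show ?thesis
      by (simp add: inner_axis' matrix_vector_mul_component inner_axis)
  qed
  ultimately show ?thesis
    by (rule continuous_on_eq)
qed

text \<open>The diagonal entry \<open>e\<^sub>j \<bullet> G e\<^sub>j\<close> lies between \<open>l\<close> and \<open>L\<close> at every point, hence so does its mean.\<close>
lemma mu_bounds:
  fixes F :: "real^'n::finite \<Rightarrow> real^'n"
  assumes F: "cell_diffeo F K" and ell: "elliptic_tensors \<G> l L" "G_hat F \<in> \<G>"
  shows "l \<le> mu F j" "mu F j \<le> L"
proof -
  let ?R = "ref_cube :: (real^'n) set"
  have meas: "?R \<in> lmeasurable"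
    by (simp add: ref_cube_def)
  have "0 \<in> (box (\<chi> i. -1) (\<chi> i. 1) :: (real^'n) set)"
    by (simp add: mem_box_cart)
  then have "box (\<chi> i. -1) (\<chi> i. 1) \<noteq> ({} :: (real^'n) set)"
    by blast
  then have "0 < measure lborel ?R"
    unfolding ref_cube_def by (simp only: content_pos_lt_eq box_ne_empty)
  then have pos: "0 < measure lebesgue ?R"
    by (simp add: ref_cube_def)
  have int: "set_integrable lebesgue ?R (\<lambda>x. G_hat F x $ j $ j)"
    using borel_integrable_compact[OF compact_ref_cube continuous_G_hat_diagonal[OF F]]
    unfolding set_integrable_def by (subst integrable_completion) (simp_all add: borel_measurable_integrable)
  have ind: "integrable lebesgue (indicator ?R :: real^'n \<Rightarrow> real)"
    using meas by (intro integrable_real_indicator) (auto simp: fmeasurable_def)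
  have const: "set_integrable lebesgue ?R (\<lambda>_. k :: real)" "(LINT x:?R|lebesgue. k) = measure lebesgue ?R * k" for k
    using ind unfolding set_integrable_def set_lebesgue_integral_def by simp_all
  have bd: "l \<le> G_hat F x $ j $ j" "G_hat F x $ j $ j \<le> L" if "x \<in> ?R" for x
  proof -
    have "l * (norm (axis j 1 :: real^'n))\<^sup>2 \<le> axis j 1 \<bullet> (G_hat F x *v axis j 1) \<and>
        axis j 1 \<bullet> (G_hat F x *v axis j 1) \<le> L * (norm (axis j 1 :: real^'n))\<^sup>2"
      using ell that unfolding elliptic_tensors_def by blast
    then show "l \<le> G_hat F x $ j $ j" "G_hat F x $ j $ j \<le> L"
      by (simp_all add: inner_axis' matrix_vector_mul_component inner_axis norm_axis_1)
  qed
  have "(LINT x:?R|lebesgue. l) \<le> (LINT x:?R|lebesgue. G_hat F x $ j $ j)"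
    "(LINT x:?R|lebesgue. G_hat F x $ j $ j) \<le> (LINT x:?R|lebesgue. L)"
    using bd by (intro set_integral_mono int const; simp)+
  then show "l \<le> mu F j" "mu F j \<le> L"
    using pos by (simp_all add: mu_def const field_simps)
qed

lemma mu_hat_quadratic_bounds:
  fixes F :: "real^'n::finite \<Rightarrow> real^'n"
  assumes F: "cell_diffeo F K" and ell: "elliptic_tensors \<G> l L" "G_hat F \<in> \<G>"
  shows "l * (norm \<xi>)\<^sup>2 \<le> \<xi> \<bullet> (mu_hat F *v \<xi>)" "\<xi> \<bullet> (mu_hat F *v \<xi>) \<le> L * (norm \<xi>)\<^sup>2"
proof -
  have "(mu_hat F *v \<xi>) $ j = mu F j * \<xi> $ j" for j
    by (simp add: mu_hat_def matrix_vector_mult_def if_distrib[of "\<lambda>x. x * _"] cong: if_cong)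
  then have "\<xi> \<bullet> (mu_hat F *v \<xi>) = (\<Sum>j\<in>UNIV. mu F j * (\<xi> $ j)\<^sup>2)"
    by (simp add: inner_vec_def power2_eq_square mult_ac)
  moreover have "(norm \<xi>)\<^sup>2 = (\<Sum>j\<in>UNIV. (\<xi> $ j)\<^sup>2)"
    unfolding power2_norm_eq_inner inner_vec_def by (simp add: power2_eq_square)
  ultimately show "l * (norm \<xi>)\<^sup>2 \<le> \<xi> \<bullet> (mu_hat F *v \<xi>)" "\<xi> \<bullet> (mu_hat F *v \<xi>) \<le> L * (norm \<xi>)\<^sup>2"
    using mu_bounds[OF F ell] by (auto simp: sum_distrib_left intro!: sum_mono mult_right_mono)
qed

section \<open>Comparison of the two energies\<close>

lemma has_weak_gradient_cong:
  assumes "open U" "\<And>x. x \<in> U \<Longrightarrow> g x = g' x" "has_weak_gradient U f g"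
  shows "has_weak_gradient U f g'"
proof -
  have "set_integrable lebesgue S g' = set_integrable lebesgue S g" if "S \<subseteq> U" for S
    using assms(2) that by (intro set_integrable_cong) auto
  then have "locally_integrable U g'"
    using assms(3) by (simp add: has_weak_gradient_def locally_integrable_def)
  moreover have "(LINT x:U|lebesgue. g' x $ j * \<phi> x) = (LINT x:U|lebesgue. g x $ j * \<phi> x)" for \<phi> j
    using assms(1,2) by (intro set_lebesgue_integral_cong) auto
  ultimately show ?thesis
    using assms(3) by (simp add: has_weak_gradient_def)
qed

lemma has_weak_gradient_weak_gradient:
  assumes "open U" "has_weak_gradient U f g"
  shows "has_weak_gradient U f (weak_gradient U f)"
proof (rule has_weak_gradient_cong[OF assms(1)])
  show "has_weak_gradient U f (SOME g. has_weak_gradient U f g)"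
    by (rule someI[of "has_weak_gradient U f", OF assms(2)])
qed (simp add: weak_gradient_def)

lemma borel_measurable_mult_matrix_inner:
  fixes r :: "'a \<Rightarrow> real^'n::finite"
  assumes "r \<in> borel_measurable M"
  shows "(\<lambda>x. r x \<bullet> (A *v r x)) \<in> borel_measurable M"
proof -
  have "continuous_on UNIV (\<lambda>v. v \<bullet> (A *v v))"
    by (intro continuous_intros matrix_vector_mult_linear_continuous_on)
  from borel_measurable_continuous_on[OF this assms] show ?thesis .
qed

text \<open>Here \<open>e\<close> is the part of the energy of \<open>v\<close> that the cell contributes and \<open>t\<close> its auxiliary energy.
  Pulled back to the reference cube, both have integrands between \<open>l \<bar>r\<bar>\<^sup>2\<close> and \<open>L \<bar>r\<bar>\<^sup>2\<close>
  almost everywhere, where \<open>r\<close> is the reference gradient.  The two inequalities avoid quotients,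
  since \<open>v\<close> may be constant on a cell.\<close>
lemma cell_energy:
  fixes F :: "real^'n::finite \<Rightarrow> real^'n"
  assumes \<Omega>: "open \<Omega>" and F: "cell_diffeo F K" and ell: "elliptic_tensors \<G> l L" "G_hat F \<in> \<G>"
    and g: "has_weak_gradient \<Omega> v (weak_gradient \<Omega> v)"
    and int: "set_integrable lebesgue \<Omega> (\<lambda>y. weak_gradient \<Omega> v y \<bullet> weak_gradient \<Omega> v y)"
  defines "U \<equiv> interior ref_cube \<inter> F -` \<Omega>"
    and "e \<equiv> (LINT y:F ` (interior ref_cube \<inter> F -` \<Omega>)|lebesgue. weak_gradient \<Omega> v y \<bullet> weak_gradient \<Omega> v y)"
    and "t \<equiv> (LINT x:ref_cube|lebesgue. ref_gradient \<Omega> F v x \<bullet> (mu_hat F *v ref_gradient \<Omega> F v x))"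
  shows "open (F ` U)" "F ` U \<subseteq> \<Omega> \<inter> K" "l * t \<le> L * e" "l * e \<le> L * t"
proof -
  let ?R = "ref_cube :: (real^'n) set"
  let ?J = "jacobian_matrix F"
  define p where "p = weak_gradient \<Omega> v"
  define r where "r = ref_gradient \<Omega> F v"
  have diff: "F differentiable_on ?R" and J: "continuous_on ?R ?J" and inv: "\<And>x. x \<in> ?R \<Longrightarrow> invertible (?J x)"
    and inj: "inj_on F ?R" and im: "F ` ?R = K"
    using F by (auto simp: cell_diffeo_def bij_betw_def)
  have contF: "continuous_on ?R F"
    by (rule differentiable_imp_continuous_on[OF diff])
  have int_sub: "interior ?R \<subseteq> ?R"
    by (rule interior_subset)
  have U_sub: "U \<subseteq> ?R"
    using int_sub by (auto simp: U_def)
  have U: "open U"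
    unfolding U_def by (rule continuous_open_preimage[OF continuous_on_subset[OF contF int_sub] open_interior \<Omega>])
  have injU: "inj_on F U"
    by (rule inj_on_subset[OF inj U_sub])
  show "open (F ` U)"
    by (rule invariance_of_domain[OF continuous_on_subset[OF contF U_sub] U injU])
  have FU: "F ` U \<subseteq> \<Omega>"
    by (auto simp: U_def)
  then show "F ` U \<subseteq> \<Omega> \<inter> K"
    using U_sub im by blast
  have der: "(F has_derivative (\<lambda>h. ?J x *v h)) (at x)" if "x \<in> U" for x
  proof -
    have "x \<in> interior ?R"
      using that by (simp add: U_def)
    then have "at x within ?R = at x"
      by (rule at_within_interior)
    then show ?thesis
      using has_derivative_jacobian_matrix[OF diff subsetD[OF U_sub that]] by metis
  qed
  have detJ: "\<forall>x\<in>U. det (?J x) \<noteq> 0"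
    using inv U_sub by (auto simp: invertible_det_nz)
  have chain: "has_weak_gradient U (v \<circ> F) (\<lambda>x. transpose (?J x) *v p (F x))"
    using has_weak_gradient_compose_diffeo[OF U \<Omega> der injU continuous_on_subset[OF J U_sub] detJ FU g]
    by (simp add: p_def)
  have r_eq: "r = weak_gradient U (v \<circ> F)"
    by (simp add: r_def ref_gradient_def U_def)
  have r_weak: "has_weak_gradient U (v \<circ> F) r"
    unfolding r_eq by (rule has_weak_gradient_weak_gradient[OF U chain])
  have r_AE: "AE x in lebesgue. x \<in> U \<longrightarrow> r x = transpose (?J x) *v p (F x)"
    by (rule weak_gradient_unique[OF U r_weak chain])
  \<comment> \<open>The integrands \<open>E\<close> of \<open>e\<close> and \<open>T\<close> of \<open>t\<close> in reference coordinates.\<close>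
  define E where "E x = \<bar>det (?J x)\<bar> * (p (F x) \<bullet> p (F x))" for x
  define T where "T x = r x \<bullet> (mu_hat F *v r x)" for x
  have intFU: "set_integrable lebesgue (F ` U) (\<lambda>y. p y \<bullet> p y)"
    using int FU \<open>open (F ` U)\<close> unfolding p_def by (rule_tac set_integrable_subset[of _ \<Omega>]) auto
  have cov: "set_integrable lebesgue (F ` U) (\<lambda>y. p y \<bullet> p y) \<longleftrightarrow> set_integrable lebesgue U E"
    "(LINT y:F ` U|lebesgue. p y \<bullet> p y) = (LINT x:U|lebesgue. E x)"
    using lebesgue_change_of_variables[of U F "\<lambda>x h. ?J x *v h" "\<lambda>y. p y \<bullet> p y"] U der injU
    by (simp_all add: has_derivative_at_withinI E_def[abs_def])
  then have intE: "set_integrable lebesgue U E" and e: "e = (LINT x:U|lebesgue. E x)"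
    using intFU by (simp_all add: e_def p_def U_def)
  have t: "t = (LINT x:U|lebesgue. T x)"
    unfolding t_def set_lebesgue_integral_def r_def[symmetric] T_def using U_sub
    by (intro Bochner_Integration.integral_cong refl) (auto simp: indicator_def r_eq weak_gradient_def)
  have bounds: "l * T x \<le> L * E x \<and> l * E x \<le> L * T x \<and> 0 \<le> T x"
    if x: "x \<in> U" and rx: "r x = transpose (?J x) *v p (F x)" for x
  proof -
    have xR: "x \<in> ?R"
      using x U_sub by blast
    have l: "0 < l" "0 < L"
      using ell(1) by (auto simp: elliptic_tensors_def)
    have "transpose (matrix_inv (?J x)) *v r x = p (F x)"
      unfolding rx by (rule matrix_inv_transpose_mult(1)[OF inv[OF xR]])
    then have E: "E x = r x \<bullet> (G_hat F x *v r x)"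
      by (simp add: G_hat_quadratic[OF xR] E_def power2_norm_eq_inner)
    have "l * (norm (r x))\<^sup>2 \<le> E x" "E x \<le> L * (norm (r x))\<^sup>2"
      using ell xR unfolding E elliptic_tensors_def by blast+
    moreover have "l * (norm (r x))\<^sup>2 \<le> T x" "T x \<le> L * (norm (r x))\<^sup>2"
      unfolding T_def by (rule mu_hat_quadratic_bounds[OF F ell])+
    moreover have "0 \<le> l * (norm (r x))\<^sup>2"
      using l by simp
    moreover have "l * T x \<le> l * (L * (norm (r x))\<^sup>2)" "l * E x \<le> l * (L * (norm (r x))\<^sup>2)"
      "L * (l * (norm (r x))\<^sup>2) \<le> L * E x" "L * (l * (norm (r x))\<^sup>2) \<le> L * T x"
      using calculation l by (intro mult_left_mono; simp)+
    ultimately show ?thesis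
      by (simp add: mult.left_commute)
  qed
  have r_meas: "r \<in> borel_measurable (lebesgue_on U)"
    using r_weak by (intro borel_measurable_locally_integrable[OF U]) (simp add: has_weak_gradient_def)
  then have "T \<in> borel_measurable (lebesgue_on U)"
    unfolding T_def by (rule borel_measurable_mult_matrix_inner)
  then have T_meas: "(\<lambda>x. indicator U x *\<^sub>R T x) \<in> borel_measurable lebesgue"
    using U by (subst (asm) borel_measurable_restrict_space_iff) auto
  \<comment> \<open>The bound by the energy density gives the integrability of \<open>T\<close>, without which \<open>t\<close> would be zero by convention.\<close>
  have intT: "set_integrable lebesgue U T"
    unfolding set_integrable_def
  proof (rule Bochner_Integration.integrable_bound[OF _ T_meas])
    show "integrable lebesgue (\<lambda>x. L / l * (indicator U x *\<^sub>R E x))"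
      using intE by (intro integrable_mult_right) (simp add: set_integrable_def)
    show "AE x in lebesgue. norm (indicator U x *\<^sub>R T x) \<le> norm (L / l * (indicator U x *\<^sub>R E x))"
      using r_AE
    proof eventually_elim
      case (elim x)
      have "0 < l"
        using ell(1) by (simp add: elliptic_tensors_def)
      show ?case
      proof (cases "x \<in> U")
        case True
        then have "l * T x \<le> L * E x" "0 \<le> T x"
          using bounds elim by blast+
        then have "T x \<le> L / l * E x"
          using \<open>0 < l\<close> by (simp add: field_simps)
        then show ?thesis
          using True \<open>0 \<le> T x\<close> by (auto intro: order_trans[OF _ abs_ge_self] simp del: abs_mult abs_divide)
      qed simp
    qed
  qed
  have mono: "(LINT x:U|lebesgue. f x) \<le> (LINT x:U|lebesgue. h x)"
    if "set_integrable lebesgue U f" "set_integrable lebesgue U h"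
      "\<And>x. x \<in> U \<Longrightarrow> r x = transpose (?J x) *v p (F x) \<Longrightarrow> f x \<le> h x" for f h :: "real^'n \<Rightarrow> real"
    unfolding set_lebesgue_integral_def
  proof (rule integral_mono_AE)
    show "AE x in lebesgue. indicator U x *\<^sub>R f x \<le> indicator U x *\<^sub>R h x"
      using r_AE by eventually_elim (use that(3) in \<open>auto simp: indicator_def\<close>)
  qed (use that(1,2) in \<open>auto simp: set_integrable_def\<close>)
  have scaled: "set_integrable lebesgue U (\<lambda>x. k * T x)" "set_integrable lebesgue U (\<lambda>x. k * E x)" for k
    using intT intE by (simp_all add: set_integrable_mult_right)
  have eqs: "k * t = (LINT x:U|lebesgue. k * T x)" "k * e = (LINT x:U|lebesgue. k * E x)" for k
    by (simp_all add: t e)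
  show "l * t \<le> L * e"
    unfolding eqs by (rule mono[OF scaled]) (use bounds in blast)
  show "l * e \<le> L * t"
    unfolding eqs by (rule mono[OF scaled(2,1)]) (use bounds in blast)
qed

text \<open>The images of the open reference cube lie in the interiors of the cells, so they are disjoint.
  They cover \<open>\<Omega>\<close> up to the images of the boundary of the cube, which are null sets because a
  differentiable map between spaces of equal dimension preserves null sets.\<close>
lemma form_a_eq_sum_cells:
  fixes F :: "(real^'n::finite) set \<Rightarrow> real^'n \<Rightarrow> real^'n"
  assumes \<Omega>: "open \<Omega>" and mesh: "is_mesh \<Omega> \<T> F"
    and op: "\<And>K. K \<in> \<T> \<Longrightarrow> open (F K ` (interior ref_cube \<inter> F K -` \<Omega>))"
    and sub: "\<And>K. K \<in> \<T> \<Longrightarrow> F K ` (interior ref_cube \<inter> F K -` \<Omega>) \<subseteq> \<Omega> \<inter> K"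
    and int: "set_integrable lebesgue \<Omega> q"
  shows "(LINT y:\<Omega>|lebesgue. q y :: real) = (\<Sum>K\<in>\<T>. LINT y:F K ` (interior ref_cube \<inter> F K -` \<Omega>)|lebesgue. q y)"
proof -
  let ?R = "ref_cube :: (real^'n) set"
  define A where "A K = F K ` (interior ?R \<inter> F K -` \<Omega>)" for K
  have fin: "finite \<T>" and cell: "\<And>K. K \<in> \<T> \<Longrightarrow> cell_diffeo (F K) K"
    and disj: "\<And>K L. K \<in> \<T> \<Longrightarrow> L \<in> \<T> \<Longrightarrow> K \<noteq> L \<Longrightarrow> interior K \<inter> interior L = {}"
    and cover: "\<Union>\<T> = closure \<Omega>"
    using mesh by (auto simp: is_mesh_def)
  have A_int: "A K \<subseteq> interior K" "A K \<subseteq> \<Omega>" "open (A K)" if "K \<in> \<T>" for K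
    unfolding A_def using op[OF that] sub[OF that] interior_maximal[OF _ op[OF that], of K] by blast+
  have "negligible (F K ` frontier ?R)" if "K \<in> \<T>" for K
  proof (rule negligible_differentiable_image_negligible)
    show "negligible (frontier ?R)"
      by (simp add: ref_cube_def negligible_convex_frontier)
    have "frontier ?R \<subseteq> ?R"
      by (rule frontier_subset_closed[OF compact_imp_closed[OF compact_ref_cube]])
    then show "F K differentiable_on frontier ?R"
      using cell[OF that] by (auto simp: cell_diffeo_def intro: differentiable_on_subset)
  qed simp
  then have "negligible (\<Union>K\<in>\<T>. F K ` frontier ?R)"
    using fin by (intro negligible_Union) auto
  then have "AE y in lebesgue. y \<notin> (\<Union>K\<in>\<T>. F K ` frontier ?R)"
    unfolding negligible_iff_null_sets by (rule AE_not_in)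
  then have AE: "AE y in lebesgue. y \<in> \<Omega> \<longrightarrow> y \<in> (\<Union>K\<in>\<T>. A K)"
  proof eventually_elim
    case (elim y)
    show ?case
    proof
      assume y: "y \<in> \<Omega>"
      then obtain K where K: "K \<in> \<T>" "y \<in> K"
        using cover closure_subset by blast
      then obtain x where x: "x \<in> ?R" "y = F K x"
        using cell[OF K(1)] by (auto simp: cell_diffeo_def bij_betw_def)
      then have "x \<notin> frontier ?R"
        using elim K(1) by blast
      then have "x \<in> interior ?R"
        using x(1) closure_subset by (auto simp: frontier_def)
      then show "y \<in> (\<Union>K\<in>\<T>. A K)"
        using K(1) x(2) y by (auto simp: A_def)
    qed
  qed
  have openA: "open (\<Union>K\<in>\<T>. A K)" and subA: "(\<Union>K\<in>\<T>. A K) \<subseteq> \<Omega>"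
    using A_int by auto
  have "set_integrable lebesgue (\<Union>K\<in>\<T>. A K) q"
    using int openA subA by (rule_tac set_integrable_subset[of _ \<Omega>]) auto
  then have "(LINT y:\<Omega>|lebesgue. q y) = (LINT y:(\<Union>K\<in>\<T>. A K)|lebesgue. q y)"
    unfolding set_lebesgue_integral_def
    using int AE subA
    by (intro integral_cong_AE) (auto simp: set_integrable_def borel_measurable_integrable indicator_def elim!: eventually_mono)
  also have "\<dots> = (\<Sum>K\<in>\<T>. LINT y:A K|lebesgue. q y)"
  proof (rule set_integral_finite_Union[OF fin])
    show "disjoint_family_on A \<T>"
      using A_int(1) disj by (fastforce simp: disjoint_family_on_def)
    show "set_integrable lebesgue (A K) q" if "K \<in> \<T>" for K
      using int A_int[OF that] by (rule_tac set_integrable_subset[of _ \<Omega>]) auto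
    show "A K \<in> sets lebesgue" if "K \<in> \<T>" for K
      using A_int(3)[OF that] by simp
  qed
  finally show ?thesis
    by (simp add: A_def)
qed

text \<open>Coercivity bounds the energy from below by a multiple of the square of the \<open>L\<^sup>2\<close> norm.\<close>
lemma form_a_pos:
  assumes coercive: "coercive_on \<Omega> (form_a \<Omega>) V" and v: "v \<in> V" "v \<in> H1 \<Omega>" and \<Omega>: "open \<Omega>"
    and nz: "\<not> (AE x in lebesgue_on \<Omega>. v x = 0)"
  shows "0 < form_a \<Omega> v v"
proof -
  obtain \<alpha> where \<alpha>: "\<alpha> > 0" "\<alpha> * (H1_norm \<Omega> v)\<^sup>2 \<le> form_a \<Omega> v v"
    using coercive v(1) by (auto simp: coercive_on_def)
  let ?i = "LINT x:\<Omega>|lebesgue. (v x)\<^sup>2"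
  let ?j = "LINT x:\<Omega>|lebesgue. (norm (weak_gradient \<Omega> v x))\<^sup>2"
  have nonneg: "0 \<le> ?i" "0 \<le> ?j"
    by (auto intro!: integral_nonneg_AE simp: set_lebesgue_integral_def)
  have int: "integrable lebesgue (\<lambda>x. indicator \<Omega> x *\<^sub>R (v x)\<^sup>2)"
    using v(2) by (simp add: H1_def set_integrable_def)
  have "?i \<noteq> 0"
  proof
    assume "?i = 0"
    then have "AE x in lebesgue. indicator \<Omega> x *\<^sub>R (v x)\<^sup>2 = 0"
      using integral_nonneg_eq_0_iff_AE[OF int] by (simp add: set_lebesgue_integral_def)
    then have "AE x in lebesgue. x \<in> \<Omega> \<longrightarrow> v x = 0"
      by eventually_elim (auto simp: indicator_def)
    then show False
      using nz \<Omega> by (simp add: AE_restrict_space_iff)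
  qed
  then have "0 < \<alpha> * (H1_norm \<Omega> v)\<^sup>2"
    using nonneg \<alpha>(1) by (simp add: H1_norm_def)
  then show ?thesis
    using \<alpha>(2) by linarith
qed

theorem theorem2p1:
  assumes "CARD('n::finite) \<in> {1, 2, 3}"
  shows "\<exists>c C :: (real^'n \<Rightarrow> real^'n^'n) set \<Rightarrow> real.
    \<forall>(\<Omega> :: (real^'n) set) \<Gamma>D \<T> F.
      open \<Omega> \<and> connected \<Omega> \<and> \<Omega> \<noteq> {} \<and> bounded \<Omega> \<and> \<Gamma>D \<subseteq> frontier \<Omega> \<and>
      coercive_on \<Omega> (form_a \<Omega>) (space_V \<Omega> \<Gamma>D) \<and> is_mesh \<Omega> \<T> F \<longrightarrow>
      (let \<G> = (\<lambda>K. G_hat (F K)) ` \<T> in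
        c \<G> > 0 \<and> C \<G> > 0 \<and>
        (\<forall>v\<in>space_V \<Omega> \<Gamma>D. \<not> (AE x in lebesgue_on \<Omega>. v x = 0) \<longrightarrow>
          c \<G> \<le> form_a \<Omega> v v / form_a_tilde \<Omega> \<T> F v v \<and>
          form_a \<Omega> v v / form_a_tilde \<Omega> \<T> F v v \<le> C \<G>))"
proof -
  \<comment> \<open>The constants are selected from the set of the tensors alone, simultaneously for all meshes.\<close>
  define q where "q \<G> = (SOME p. elliptic_tensors \<G> (fst p) (snd p))" for \<G> :: "(real^'n \<Rightarrow> real^'n^'n) set"
  define l where "l \<G> = fst (q \<G>)" for \<G>
  define L where "L \<G> = snd (q \<G>)" for \<G>
  have lL: "elliptic_tensors \<G> (l \<G>) (L \<G>)" if "elliptic_tensors \<G> a b" for \<G> a b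
    unfolding l_def L_def q_def
    by (rule someI[of "\<lambda>p. elliptic_tensors \<G> (fst p) (snd p)" "(a, b)"]) (simp add: that)
  show ?thesis
  proof (intro exI allI impI, elim conjE, unfold Let_def)
    fix \<Omega> \<Gamma>D :: "(real^'n) set" and \<T> F
    assume \<Omega>: "open \<Omega>" and coercive: "coercive_on \<Omega> (form_a \<Omega>) (space_V \<Omega> \<Gamma>D)" and mesh: "is_mesh \<Omega> \<T> F"
    define \<G> where "\<G> = (\<lambda>K. G_hat (F K)) ` \<T>"
    have fin: "finite \<T>" and cell: "\<And>K. K \<in> \<T> \<Longrightarrow> cell_diffeo (F K) K"
      using mesh by (auto simp: is_mesh_def)
    have ell: "elliptic_tensors \<G> (l \<G>) (L \<G>)"
      using mesh_tensors_elliptic[of \<T> F] fin cell lL unfolding \<G>_def by blast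
    then have pos: "0 < l \<G>" "0 < L \<G>"
      by (auto simp: elliptic_tensors_def)
    have quotient: "l \<G> / L \<G> \<le> form_a \<Omega> v v / form_a_tilde \<Omega> \<T> F v v \<and>
        form_a \<Omega> v v / form_a_tilde \<Omega> \<T> F v v \<le> L \<G> / l \<G>"
      if v: "v \<in> space_V \<Omega> \<Gamma>D" and nz: "\<not> (AE x in lebesgue_on \<Omega>. v x = 0)" for v
    proof -
      have H1: "v \<in> H1 \<Omega>"
        using v by (simp add: space_V_def)
      have a: "0 < form_a \<Omega> v v"
        by (rule form_a_pos[OF coercive v H1 \<Omega> nz])
      let ?q = "\<lambda>y. weak_gradient \<Omega> v y \<bullet> weak_gradient \<Omega> v y"
      \<comment> \<open>The integral of a function that is not integrable is zero, but the energy is positive.\<close>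
      have int: "set_integrable lebesgue \<Omega> ?q"
      proof (rule ccontr)
        assume "\<not> ?thesis"
        then have "form_a \<Omega> v v = 0"
          by (simp add: form_a_def set_lebesgue_integral_def set_integrable_def not_integrable_integral_eq)
        then show False
          using a by simp
      qed
      have g: "has_weak_gradient \<Omega> v (weak_gradient \<Omega> v)"
        using H1 has_weak_gradient_weak_gradient[OF \<Omega>] by (auto simp: H1_def)
      let ?e = "\<lambda>K. LINT y:F K ` (interior ref_cube \<inter> F K -` \<Omega>)|lebesgue. ?q y"
      let ?t = "\<lambda>K. LINT x:ref_cube|lebesgue.
        ref_gradient \<Omega> (F K) v x \<bullet> (mu_hat (F K) *v ref_gradient \<Omega> (F K) v x)"
      have K: "open (F K ` (interior ref_cube \<inter> F K -` \<Omega>))" "F K ` (interior ref_cube \<inter> F K -` \<Omega>) \<subseteq> \<Omega> \<inter> K"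
        "l \<G> * ?t K \<le> L \<G> * ?e K" "l \<G> * ?e K \<le> L \<G> * ?t K" if "K \<in> \<T>" for K
        using cell_energy[OF \<Omega> cell[OF that] ell _ g int] that by (auto simp: \<G>_def)
      have sum: "form_a \<Omega> v v = (\<Sum>K\<in>\<T>. ?e K)"
        unfolding form_a_def by (rule form_a_eq_sum_cells[OF \<Omega> mesh K(1,2) int])
      have up: "l \<G> * form_a_tilde \<Omega> \<T> F v v \<le> L \<G> * form_a \<Omega> v v"
        unfolding sum form_a_tilde_def sum_distrib_left by (rule sum_mono[OF K(3)])
      have low: "l \<G> * form_a \<Omega> v v \<le> L \<G> * form_a_tilde \<Omega> \<T> F v v"
        unfolding sum form_a_tilde_def sum_distrib_left by (rule sum_mono[OF K(4)])
      \<comment> \<open>Positivity of the denominator, so that the quotient does not degenerate to division by zero.\<close>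
      have "0 < L \<G> * form_a_tilde \<Omega> \<T> F v v"
        using low a pos(1) by (intro less_le_trans[OF mult_pos_pos low]) auto
      then have t: "0 < form_a_tilde \<Omega> \<T> F v v"
        using pos(2) by (simp add: zero_less_mult_iff)
      show ?thesis
        using up low t pos by (simp add: field_simps)
    qed
    show "0 < (\<lambda>\<G>. l \<G> / L \<G>) ((\<lambda>K. G_hat (F K)) ` \<T>) \<and> 0 < (\<lambda>\<G>. L \<G> / l \<G>) ((\<lambda>K. G_hat (F K)) ` \<T>) \<and>
      (\<forall>v\<in>space_V \<Omega> \<Gamma>D. \<not> (AE x in lebesgue_on \<Omega>. v x = 0) \<longrightarrow>
        (\<lambda>\<G>. l \<G> / L \<G>) ((\<lambda>K. G_hat (F K)) ` \<T>) \<le> form_a \<Omega> v v / form_a_tilde \<Omega> \<T> F v v \<and>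
        form_a \<Omega> v v / form_a_tilde \<Omega> \<T> F v v \<le> (\<lambda>\<G>. L \<G> / l \<G>) ((\<lambda>K. G_hat (F K)) ` \<T>))"
      using quotient pos unfolding \<G>_def[symmetric] by simp
  qed
qed

end
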